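(* As $n\to\infty$, $f_{n-2}(n)<v_n^{0.5+o(1)}$. That is, for every $\varepsilon>0$ there is $n_0$ such that $f_{n-2}(n)<v_n^{1/2+\varepsilon}$ for all integers $n\ge n_0$.
   Context: For $1\le j\le n$, $\sigma_j(x_1,\dots,x_n)=\sum_{1\le i_1<\dots<i_j\le n}x_{i_1}\cdots x_{i_j}$. For $n\ge 3$, $f_{n-2}(n)$ is the (finite) number of $n$-tuples of integers $(x_1,\dots,x_n)$ with $1\le x_1\le\dots\le x_n$ and $\sigma_{n-2}(x_1,\dots,x_n)=\sigma_n(x_1,\dots,x_n)$. The sequence $(v_n)_{n\ge1}$ is defined recursively by $v_1=1$, $v_2=2$, and for $n\ge 2$ $$v_{n+1}=1+\frac{\sum_{1\le i\le n}\frac{1}{v_i}}{1-\sum_{1\le i<j\le n}\frac{1}{v_iv_j}}.$$ Its first terms are $1,2,4,15,219,47863,\dots$; it is an increasing sequence of positive integers. *)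

theory Defs
  imports Complex_Main
begin

definition sigma :: "nat \<Rightarrow> int list \<Rightarrow> int" where
  "sigma j xs = (\<Sum>I | I \<subseteq> {..<length xs} \<and> card I = j. \<Prod>i\<in>I. xs ! i)"

text \<open>
  Tuples \<open>(x\<^sub>1, \<dots>, x\<^sub>n)\<close> are lists of length \<open>n\<close>. The subtraction \<open>n - 2\<close> is the
  intended one for \<open>n \<ge> 2\<close>; only \<open>n \<ge> 3\<close> is of interest.
\<close>

definition sols :: "nat \<Rightarrow> int list set" where
  "sols n = {xs. length xs = n \<and> (\<forall>x\<in>set xs. 1 \<le> x) \<and> sorted xs \<and>
                 sigma (n - 2) xs = sigma n xs}"

definition num_sols :: "nat \<Rightarrow> nat" where
  "num_sols n = card (sols n)"

text \<open>The argument \<open>0\<close> is outside the range of the sequence and gets a dummy value.\<close>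

context
  notes sum.cong [fundef_cong]
begin

fun vseq :: "nat \<Rightarrow> real" where
  "vseq 0 = 0"
| "vseq (Suc 0) = 1"
| "vseq (Suc (Suc 0)) = 2"
| "vseq (Suc (Suc (Suc m))) =
     1 + (\<Sum>i\<in>{1..m + 2}. 1 / vseq i) /
         (1 - (\<Sum>j\<in>{1..m + 2}. \<Sum>i\<in>{1..<j}. 1 / (vseq i * vseq j)))"

end

lemma vseq_rec:
  assumes "n \<ge> 2"
  shows "vseq (n + 1) = 1 + (\<Sum>i=1..n. 1 / vseq i) / (1 - (\<Sum>j=1..n. \<Sum>i=1..<j. 1 / (vseq i * vseq j)))"
proof -
  from assms obtain m where "n = m + 2"
    using le_Suc_ex by (metis add.commute)
  then show ?thesis by simp
qed

text \<open>
  The set of solutions is finite, so its cardinality is not the default value for infinite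
  sets: otherwise some solution would be dominated componentwise by a different one, but
  \<open>\<sigma>\<^sub>n\<^sub>-\<^sub>2 / \<sigma>\<^sub>n\<close> is strictly decreasing in every component.
\<close>

lemma int_seq_incseq_subseq:
  fixes s :: "nat \<Rightarrow> int"
  assumes "\<And>m. s m \<ge> 1"
  shows "\<exists>r :: nat \<Rightarrow> nat. strict_mono r \<and> mono (s \<circ> r)"
proof -
  obtain r :: "nat \<Rightarrow> nat" where r: "strict_mono r" "monoseq (\<lambda>m. s (r m))"
    using seq_monosub by metis
  then consider "mono (\<lambda>m. s (r m))" | "antimono (\<lambda>m. s (r m))"
    by (auto simp: monoseq_iff)
  then show ?thesis
  proof cases
    case 1
    with r(1) show ?thesis by (intro exI[of _ r]) (simp add: comp_def)
  next
    case 2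
    define k where "k = (ARG_MIN (\<lambda>m. nat (s (r m))) m. True)"
    have k: "s (r k) \<le> s (r m)" for m
      using arg_min_nat_le[of "\<lambda>_. True" m "\<lambda>m. nat (s (r m))"] assms[of "r m"]
      unfolding k_def by simp
    have "s (r (k + m)) = s (r k)" for m
      using k[of "k + m"] antimonoD[OF 2, of k "k + m"] by simp
    moreover have "strict_mono (\<lambda>m. r (k + m))"
      using r(1) by (simp add: strict_mono_def)
    ultimately show ?thesis
      by (intro exI[of _ "\<lambda>m. r (k + m)"]) (simp add: mono_def)
  qed
qed

lemma list_seq_incseq_subseq:
  fixes s :: "nat \<Rightarrow> int list"
  assumes "\<And>m i. i < n \<Longrightarrow> s m ! i \<ge> 1"
  shows "\<exists>r :: nat \<Rightarrow> nat. strict_mono r \<and> (\<forall>i<n. mono (\<lambda>m. s (r m) ! i))"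
  using assms
proof (induction n)
  case 0
  show ?case by (rule exI[of _ id]) (simp add: strict_mono_def)
next
  case (Suc n)
  then obtain r :: "nat \<Rightarrow> nat" where r: "strict_mono r" "\<forall>i<n. mono (\<lambda>m. s (r m) ! i)"
    by (metis less_Suc_eq)
  obtain q :: "nat \<Rightarrow> nat" where q: "strict_mono q" "mono ((\<lambda>m. s (r m) ! n) \<circ> q)"
    using int_seq_incseq_subseq[of "\<lambda>m. s (r m) ! n"] Suc.prems by auto
  have "mono (\<lambda>m. s (r (q m)) ! i)" if "i < Suc n" for i
  proof (cases "i = n")
    case True
    with q(2) show ?thesis by (simp add: comp_def)
  next
    case False
    then have "mono (\<lambda>m. s (r m) ! i)" using r(2) that by simp
    then show ?thesis
      using q(1) by (meson mono_def strict_mono_mono)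
  qed
  moreover have "strict_mono (\<lambda>m. r (q m))"
    using r(1) q(1) by (simp add: strict_mono_def)
  ultimately show ?case by blast
qed

lemma sigma_ratio_strict:
  assumes len: "length xs = n" "length ys = n"
    and pos: "\<And>i. i < n \<Longrightarrow> 1 \<le> xs ! i"
    and le: "\<And>i. i < n \<Longrightarrow> xs ! i \<le> ys ! i"
    and "xs \<noteq> ys"
  shows "sigma (n - 2) ys * sigma n xs < sigma (n - 2) xs * sigma n ys"
proof -
  have top: "sigma n zs = (\<Prod>i<n. zs ! i)" if "length zs = n" for zs
  proof -
    have "{I. I \<subseteq> {..<n} \<and> card I = n} = {{..<n}}"
      by (auto dest: card_subset_eq[rotated])
    with that show ?thesis by (simp add: sigma_def)
  qed
  obtain k where k: "k < n" "xs ! k < ys ! k"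
    using len le \<open>xs \<noteq> ys\<close> by (metis nth_equalityI order_le_less)
  have split: "(\<Prod>i<n. zs ! i) = (\<Prod>i\<in>I. zs ! i) * (\<Prod>i\<in>{..<n} - I. zs ! i)"
    if "I \<subseteq> {..<n}" for I and zs :: "int list"
    using that by (subst prod.subset_diff[OF that]) (simp_all add: mult.commute)
  have ppos: "(\<Prod>i\<in>I. zs ! i) > 0" if "I \<subseteq> {..<n}" "zs = xs \<or> zs = ys" for I zs
    using that pos le by (intro prod_pos) fastforce
  define A where "A = {I. I \<subseteq> {..<n} \<and> card I = n - 2}"
  have fin: "finite A"
    unfolding A_def by (rule finite_subset[of _ "Pow {..<n}"]) auto
  have term_le: "(\<Prod>i\<in>I. ys ! i) * (\<Prod>i<n. xs ! i) \<le> (\<Prod>i\<in>I. xs ! i) * (\<Prod>i<n. ys ! i)"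
    if "I \<in> A" for I
  proof -
    have I: "I \<subseteq> {..<n}" using that by (simp add: A_def)
    have "(\<Prod>i\<in>{..<n} - I. xs ! i) \<le> (\<Prod>i\<in>{..<n} - I. ys ! i)"
      using pos le by (intro prod_mono) fastforce
    then have "((\<Prod>i\<in>I. ys ! i) * (\<Prod>i\<in>I. xs ! i)) * (\<Prod>i\<in>{..<n} - I. xs ! i)
             \<le> ((\<Prod>i\<in>I. ys ! i) * (\<Prod>i\<in>I. xs ! i)) * (\<Prod>i\<in>{..<n} - I. ys ! i)"
      using ppos[OF I] by (intro mult_left_mono) (auto intro!: mult_nonneg_nonneg simp: less_imp_le)
    then show ?thesis
      unfolding split[OF I] by (simp only: mult_ac)
  qed
  have "card ({..<n} - {k}) \<ge> n - 2" using k by simp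
  then obtain J where J: "J \<subseteq> {..<n} - {k}" "card J = n - 2"
    by (meson obtain_subset_with_card_n)
  then have JA: "J \<in> A" and J': "J \<subseteq> {..<n}" and kJ: "k \<in> {..<n} - J"
    using k by (auto simp: A_def)
  have "(\<Prod>i\<in>{..<n} - J. xs ! i) < (\<Prod>i\<in>{..<n} - J. ys ! i)"
  proof -
    have "(\<Prod>i\<in>{..<n} - J - {k}. xs ! i) \<le> (\<Prod>i\<in>{..<n} - J - {k}. ys ! i)"
      using pos le by (intro prod_mono) fastforce
    moreover have "(\<Prod>i\<in>{..<n} - J - {k}. ys ! i) > 0"
      by (rule ppos) auto
    ultimately show ?thesis
      using k kJ pos[of k] by (simp add: prod.remove[OF _ kJ] mult_less_le_imp_less
        order_le_less_trans[OF mult_left_mono mult_strict_right_mono])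
  qed
  then have "((\<Prod>i\<in>J. ys ! i) * (\<Prod>i\<in>J. xs ! i)) * (\<Prod>i\<in>{..<n} - J. xs ! i)
           < ((\<Prod>i\<in>J. ys ! i) * (\<Prod>i\<in>J. xs ! i)) * (\<Prod>i\<in>{..<n} - J. ys ! i)"
    using ppos[OF J'] by (intro mult_strict_left_mono) auto
  then have "(\<Prod>i\<in>J. ys ! i) * (\<Prod>i<n. xs ! i) < (\<Prod>i\<in>J. xs ! i) * (\<Prod>i<n. ys ! i)"
    unfolding split[OF J'] by (simp only: mult_ac)
  then have "(\<Sum>I\<in>A. (\<Prod>i\<in>I. ys ! i) * (\<Prod>i<n. xs ! i))
           < (\<Sum>I\<in>A. (\<Prod>i\<in>I. xs ! i) * (\<Prod>i<n. ys ! i))"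
    using fin JA term_le by (intro sum_strict_mono_ex1) auto
  then show ?thesis
    unfolding top[OF len(1)] top[OF len(2)]
    by (simp add: sigma_def len sum_distrib_right A_def)
qed

lemma finite_sols: "finite (sols n)"
proof (rule ccontr)
  assume "infinite (sols n)"
  then obtain s :: "nat \<Rightarrow> int list" where s: "inj s" "range s \<subseteq> sols n"
    using infinite_countable_subset by blast
  have len: "length (s m) = n" for m
    using s(2) by (auto simp: sols_def)
  have pos: "s m ! i \<ge> 1" if "i < n" for m i
  proof -
    have "s m \<in> sols n" using s(2) by blast
    then show ?thesis using that len[of m] by (simp add: sols_def)
  qed
  have eq: "sigma (n - 2) (s m) = sigma n (s m)" for m
    using s(2) by (auto simp: sols_def)
  obtain r :: "nat \<Rightarrow> nat" where r: "strict_mono r" "\<forall>i<n. mono (\<lambda>m. s (r m) ! i)"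
    using list_seq_incseq_subseq[of n s] pos by blast
  have "r 0 \<noteq> r 1"
    using r(1) by (metis less_irrefl strict_monoD zero_less_one)
  then have "s (r 0) \<noteq> s (r 1)"
    using s(1) by (simp add: inj_eq)
  moreover have "s (r 0) ! i \<le> s (r 1) ! i" if "i < n" for i
    using r(2) that by (meson monoD zero_le)
  ultimately have "sigma (n - 2) (s (r 1)) * sigma n (s (r 0)) < sigma (n - 2) (s (r 0)) * sigma n (s (r 1))"
    using sigma_ratio_strict[OF len len pos] by blast
  then show False
    by (simp add: eq mult.commute)
qed

end

theory Submission
  imports Defs "HOL-Computational_Algebra.Primes" "HOL-Real_Asymp.Real_Asymp"
begin

text \<open>
  The equation says that the second elementary symmetric function \<open>e\<close> of the reciprocals is \<open>1\<close>.
  Among all sorted positive integer sequences of length \<open>k\<close> with \<open>e < 1\<close>, the sequence \<open>v\<close>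
  maximises \<open>e\<close>, with gap \<open>1 - e = 1 / (v\<^sub>1 \<cdots> v\<^sub>k)\<close>. In a solution the sum of the reciprocals is at
  most \<open>2\<close>, so the entry after a prefix of length \<open>k\<close> is at most \<open>2 n v\<^sub>1 \<cdots> v\<^sub>k\<close>. Multiplying
  these bounds, there are at most \<open>(2 n)\<^sup>n v\<^sub>1 \<cdots> v\<^bsub>n-2\<^esub>\<close> prefixes of length \<open>n - 2\<close>, and
  \<open>(v\<^sub>1 \<cdots> v\<^bsub>n-2\<^esub>)\<^sup>2 \<le> v\<^sub>n\<close>. The last two entries come from a factorisation of an integer of size
  \<open>v\<^sub>n\<close> up to such factors, hence contribute \<open>v\<^sub>n\<^sup>o\<^sup>(\<^sup>1\<^sup>)\<close> by the divisor bound; and \<open>(2 n)\<^sup>n\<close> is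
  negligible because \<open>v\<^sub>n\<close> grows doubly exponentially.
\<close>

section \<open>Power sums and elementary symmetric functions of reciprocals\<close>

definition recip_sum :: "(nat \<Rightarrow> real) \<Rightarrow> nat \<Rightarrow> real" where
  "recip_sum x k = (\<Sum>i<k. 1 / x i)"

text \<open>The second elementary symmetric function of the reciprocals, grouped by the larger index
  so that a new entry adds a single term.\<close>

definition recip_pairs :: "(nat \<Rightarrow> real) \<Rightarrow> nat \<Rightarrow> real" where
  "recip_pairs x k = (\<Sum>j<k. recip_sum x j / x j)"

definition recip_squares :: "(nat \<Rightarrow> real) \<Rightarrow> nat \<Rightarrow> real" where
  "recip_squares x k = (\<Sum>i<k. 1 / (x i)\<^sup>2)"

definition partial_prod :: "(nat \<Rightarrow> real) \<Rightarrow> nat \<Rightarrow> real" where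
  "partial_prod x k = (\<Prod>i<k. x i)"

lemma recip_sum_0 [simp]: "recip_sum x 0 = 0"
  and recip_sum_Suc [simp]: "recip_sum x (Suc k) = recip_sum x k + 1 / x k"
  by (simp_all add: recip_sum_def)

lemma recip_pairs_0 [simp]: "recip_pairs x 0 = 0"
  and recip_pairs_Suc [simp]: "recip_pairs x (Suc k) = recip_pairs x k + recip_sum x k / x k"
  by (simp_all add: recip_pairs_def)

lemma recip_squares_0 [simp]: "recip_squares x 0 = 0"
  and recip_squares_Suc [simp]: "recip_squares x (Suc k) = recip_squares x k + 1 / (x k)\<^sup>2"
  by (simp_all add: recip_squares_def)

lemma partial_prod_0 [simp]: "partial_prod x 0 = 1"
  and partial_prod_Suc [simp]: "partial_prod x (Suc k) = partial_prod x k * x k"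
  by (simp_all add: partial_prod_def)

lemma recip_cong:
  assumes "\<And>i. i < k \<Longrightarrow> x i = y i"
  shows "recip_sum x k = recip_sum y k" "recip_pairs x k = recip_pairs y k"
    "recip_squares x k = recip_squares y k" "partial_prod x k = partial_prod y k"
  using assms by (induction k) auto

text \<open>Newton's identity for the first two power sums of the reciprocals.\<close>

lemma recip_sum_square: "(recip_sum x k)\<^sup>2 = recip_squares x k + 2 * recip_pairs x k"
  by (induction k) (simp_all add: power2_eq_square algebra_simps)

lemma recip_sum_add: "recip_sum x (j + m) = recip_sum x j + recip_sum (\<lambda>i. x (j + i)) m"
  by (induction m) simp_all

lemma recip_pairs_add:
  "recip_pairs x (j + m) =
     recip_pairs x j + recip_sum x j * recip_sum (\<lambda>i. x (j + i)) m + recip_pairs (\<lambda>i. x (j + i)) m"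
  by (induction m) (simp_all add: recip_sum_add distrib_left add_divide_distrib)

lemma recip_squares_add:
  "recip_squares x (j + m) = recip_squares x j + recip_squares (\<lambda>i. x (j + i)) m"
  by (induction m) simp_all

lemma partial_prod_add:
  "partial_prod x (j + m) = partial_prod x j * partial_prod (\<lambda>i. x (j + i)) m"
  by (induction m) simp_all

lemma partial_prod_pos: "(\<And>i. i < k \<Longrightarrow> x i > 0) \<Longrightarrow> partial_prod x k > 0"
  by (induction k) auto

lemma recip_sum_nonneg: "(\<And>i. i < k \<Longrightarrow> x i > 0) \<Longrightarrow> recip_sum x k \<ge> 0"
  unfolding recip_sum_def by (intro sum_nonneg) (auto intro: less_imp_le)

lemma recip_pairs_nonneg: "(\<And>i. i < k \<Longrightarrow> x i > 0) \<Longrightarrow> recip_pairs x k \<ge> 0"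
  unfolding recip_pairs_def
  by (intro sum_nonneg divide_nonneg_pos recip_sum_nonneg) auto

lemma recip_squares_nonneg: "recip_squares x k \<ge> 0"
  unfolding recip_squares_def by (intro sum_nonneg) auto

lemma recip_mono:
  assumes "j \<le> k" "\<And>i. i < k \<Longrightarrow> x i > 0"
  shows "recip_sum x j \<le> recip_sum x k" "recip_pairs x j \<le> recip_pairs x k"
    "recip_squares x j \<le> recip_squares x k"
proof -
  obtain m where k: "k = j + m"
    using assms(1) le_Suc_ex by blast
  have pos: "x (j + i) > 0" if "i < m" for i
    using that assms(2) k by simp
  have nn: "recip_sum x j \<ge> 0" "recip_sum (\<lambda>i. x (j + i)) m \<ge> 0" "recip_pairs (\<lambda>i. x (j + i)) m \<ge> 0"
    "recip_squares (\<lambda>i. x (j + i)) m \<ge> 0"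
    using pos assms k by (auto intro!: recip_sum_nonneg recip_pairs_nonneg recip_squares_nonneg)
  then show "recip_sum x j \<le> recip_sum x k" "recip_pairs x j \<le> recip_pairs x k"
    "recip_squares x j \<le> recip_squares x k"
    by (simp_all add: k recip_sum_add recip_pairs_add recip_squares_add)
qed

lemma recip_squares_le_recip_sum:
  assumes "c > 0" "\<And>i. i < k \<Longrightarrow> c \<le> x i"
  shows "recip_squares x k \<le> recip_sum x k / c"
proof -
  have "1 / (x i)\<^sup>2 \<le> 1 / x i / c" if "i < k" for i
    using assms(1) assms(2)[OF that] by (simp add: power2_eq_square field_simps)
  then show ?thesis
    unfolding recip_squares_def recip_sum_def sum_divide_distrib by (intro sum_mono) auto
qed

text \<open>Multiplying by the product clears all denominators and leaves elementary symmetric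
  functions of the entries themselves.\<close>

lemma recip_prod_Ints:
  assumes "\<And>i. i < k \<Longrightarrow> x i \<in> \<int>" "\<And>i. i < k \<Longrightarrow> x i > 0"
  shows "partial_prod x k \<in> \<int>" "partial_prod x k * recip_sum x k \<in> \<int>"
    "partial_prod x k * recip_pairs x k \<in> \<int>"
proof -
  have "partial_prod x k \<in> \<int> \<and> partial_prod x k * recip_sum x k \<in> \<int> \<and>
      partial_prod x k * recip_pairs x k \<in> \<int>"
    using assms
  proof (induction k)
    case (Suc k)
    have xk: "x k \<in> \<int>" "x k \<noteq> 0"
      using Suc.prems(1)[of k] Suc.prems(2)[of k] by auto
    have eq: "partial_prod x (Suc k) * recip_sum x (Suc k) =
        x k * (partial_prod x k * recip_sum x k) + partial_prod x k"
      "partial_prod x (Suc k) * recip_pairs x (Suc k) =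
        x k * (partial_prod x k * recip_pairs x k) + partial_prod x k * recip_sum x k"
      using xk by (simp_all add: field_simps)
    show ?case
      unfolding eq using Suc xk by auto
  qed simp_all
  then show "partial_prod x k \<in> \<int>" "partial_prod x k * recip_sum x k \<in> \<int>"
    "partial_prod x k * recip_pairs x k \<in> \<int>" by auto
qed

text \<open>The gap times the product is a positive integer, hence at least 1.\<close>

lemma recip_pairs_gap:
  assumes "\<And>i. i < k \<Longrightarrow> x i \<in> \<int>" "\<And>i. i < k \<Longrightarrow> x i > 0" "recip_pairs x k < 1"
  shows "1 / partial_prod x k \<le> 1 - recip_pairs x k"
proof -
  have pos: "partial_prod x k > 0"
    using assms(2) by (rule partial_prod_pos)
  have "partial_prod x k * (1 - recip_pairs x k) \<in> \<int>"
    using recip_prod_Ints[OF assms(1,2)] by (simp add: right_diff_distrib)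
  moreover have "partial_prod x k * (1 - recip_pairs x k) > 0"
    using pos assms(3) by simp
  ultimately have "partial_prod x k * (1 - recip_pairs x k) \<ge> 1"
    by (metis Ints_nonzero_abs_ge1 abs_of_pos less_irrefl)
  then show ?thesis
    using pos by (simp add: field_simps)
qed

subsection \<open>Comparison by partial products\<close>

text \<open>Summation by parts. The induction keeps the weighted sum above the partial sum of
  \<open>d\<close> times the last weight.\<close>

lemma abel_sum_nonneg:
  fixes d c :: "nat \<Rightarrow> real"
  assumes "\<And>i. i \<le> n \<Longrightarrow> (\<Sum>l<i. d l) \<ge> 0"
    and "\<And>i. i < n \<Longrightarrow> c i \<ge> 0" and "\<And>i. Suc i < n \<Longrightarrow> c (Suc i) \<le> c i"
  shows "(\<Sum>i<n. d i * c i) \<ge> 0"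
proof (cases n)
  case (Suc m)
  have "(\<Sum>i<Suc k. d i * c i) \<ge> (\<Sum>l<Suc k. d l) * c k" if "k < n" for k
    using that
  proof (induction k)
    case (Suc k)
    have "(\<Sum>l<Suc k. d l) * c (Suc k) \<le> (\<Sum>l<Suc k. d l) * c k"
      using assms(1)[of "Suc k"] assms(3)[of k] Suc.prems by (intro mult_left_mono) auto
    with Suc show ?case
      by (simp add: algebra_simps)
  qed simp
  from this[of m] have "(\<Sum>i<n. d i * c i) \<ge> (\<Sum>l<n. d l) * c m"
    using Suc by simp
  moreover have "(\<Sum>l<n. d l) * c m \<ge> 0"
    using assms(1)[of n] assms(2)[of m] Suc by simp
  ultimately show ?thesis by linarith
qed simp

text \<open>Collecting the coefficient of \<open>d i\<close>: it meets \<open>y i * y l\<close> once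
  for every \<open>l\<close> different from \<open>i\<close>.\<close>

lemma pair_sum_rearrange:
  fixes d y :: "nat \<Rightarrow> real"
  shows "(\<Sum>j<n. \<Sum>i<j. (d i + d j) * (y i * y j)) = (\<Sum>i<n. d i * (y i * ((\<Sum>l<n. y l) - y i)))"
proof (induction n)
  case (Suc n)
  have "(\<Sum>i<n. d i * (y i * ((\<Sum>l<Suc n. y l) - y i)))
      = (\<Sum>i<n. d i * (y i * ((\<Sum>l<n. y l) - y i))) + (\<Sum>i<n. d i * (y i * y n))"
    by (simp add: sum.distrib[symmetric] algebra_simps)
  moreover have "(\<Sum>i<n. (d i + d n) * (y i * y n))
      = (\<Sum>i<n. d i * (y i * y n)) + d n * (y n * (\<Sum>l<n. y l))"
    by (simp add: sum.distrib sum_distrib_left algebra_simps)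
  ultimately show ?case
    using Suc.IH by simp
qed simp

text \<open>The convex function \<open>exp (-t)\<close> lies above its tangent at
  \<open>t = ln a\<close>; this is evaluated at \<open>t = ln b\<close>.\<close>

lemma inverse_diff_ge_ln:
  fixes a b :: real
  assumes "a > 0" "b > 0"
  shows "(ln a - ln b) * (1 / a) \<le> 1 / b - 1 / a"
proof -
  have "ln (a / b) \<le> a / b - 1"
    using assms by (intro ln_le_minus_one) auto
  then have "(ln a - ln b) * (1 / a) \<le> (a / b - 1) * (1 / a)"
    using assms by (intro mult_right_mono) (auto simp: ln_div)
  also have "\<dots> = 1 / b - 1 / a"
    using assms by (simp add: field_simps)
  finally show ?thesis .
qed

text \<open>
  In the logarithms of the arguments, \<open>C * recip_sum + recip_pairs\<close> is a sum of exponentials of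
  linear forms, hence convex. Its gradient at \<open>x\<close> has decreasing weights
  \<open>y (C + s - y)\<close> with \<open>y = 1 / x i\<close>, so that Abel summation applies.
\<close>

lemma recip_le_of_partial_prod_ge:
  fixes x w :: "nat \<Rightarrow> real"
  assumes x: "\<And>i. i < n \<Longrightarrow> x i > 0" and w: "\<And>i. i < n \<Longrightarrow> w i > 0"
    and sorted: "\<And>i. Suc i < n \<Longrightarrow> x i \<le> x (Suc i)"
    and prod: "\<And>i. i \<le> n \<Longrightarrow> partial_prod w i \<le> partial_prod x i"
    and "C \<ge> 0"
  shows "C * recip_sum x n + recip_pairs x n \<le> C * recip_sum w n + recip_pairs w n"
proof -
  define d y where "d = (\<lambda>i. ln (x i) - ln (w i))" and "y = (\<lambda>i. 1 / x i)"
  define s where "s = (\<Sum>l<n. y l)"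
  have y: "y i > 0" if "i < n" for i
    using x that by (simp add: y_def)
  have ln_prod: "(\<Sum>l<i. ln (z l)) = ln (partial_prod z i)"
    if "i \<le> n" "\<And>i. i < n \<Longrightarrow> z i > 0" for i and z :: "nat \<Rightarrow> real"
    using that unfolding partial_prod_def by (subst ln_prod) (auto dest!: order_less_le_trans simp: less_le)
  have D: "(\<Sum>l<i. d l) \<ge> 0" if "i \<le> n" for i
  proof -
    have "partial_prod w i > 0"
      using that w by (intro partial_prod_pos) auto
    then have "ln (partial_prod w i) \<le> ln (partial_prod x i)"
      using prod[OF that] by simp
    then show ?thesis
      using ln_prod[OF that x] ln_prod[OF that w] by (simp add: d_def sum_subtractf)
  qed
  have two: "y i + y j \<le> s" if "i < n" "j < n" "i \<noteq> j" for i j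
  proof -
    have "sum y {i, j} \<le> s"
      unfolding s_def using that y by (intro sum_mono2) (auto intro: less_imp_le)
    with that show ?thesis by simp
  qed
  have grad: "0 \<le> (\<Sum>i<n. d i * (y i * (C + s - y i)))"
  proof (rule abel_sum_nonneg)
    fix i assume "i < n"
    then have "y i \<le> s"
      unfolding s_def using y by (intro member_le_sum) (auto intro: less_imp_le)
    then show "0 \<le> y i * (C + s - y i)"
      using y[OF \<open>i < n\<close>] \<open>C \<ge> 0\<close> by simp
  next
    fix i assume i: "Suc i < n"
    have "y (Suc i) \<le> y i"
      using sorted[OF i] x[of i] i by (simp add: y_def frac_le)
    \<comment> \<open>The product is exactly the difference of the weights at \<open>i\<close> and
      \<open>Suc i\<close>; \<open>two\<close> makes its second factor nonnegative.\<close>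
    then have "0 \<le> (y i - y (Suc i)) * (C + s - y i - y (Suc i))"
      using two[of i "Suc i"] i \<open>C \<ge> 0\<close> by (intro mult_nonneg_nonneg) auto
    then show "y (Suc i) * (C + s - y (Suc i)) \<le> y i * (C + s - y i)"
      by (simp add: algebra_simps)
  qed (use D in auto)
  have pairs: "recip_pairs z n = (\<Sum>j<n. \<Sum>i<j. 1 / (z i * z j))" for z
    by (simp add: recip_pairs_def recip_sum_def sum_divide_distrib)
  have "(\<Sum>i<n. d i * y i) \<le> (\<Sum>i<n. 1 / w i - 1 / x i)"
    unfolding d_def y_def using x w by (intro sum_mono inverse_diff_ge_ln) auto
  then have 1: "(\<Sum>i<n. d i * y i) \<le> recip_sum w n - recip_sum x n"
    by (simp add: recip_sum_def sum_subtractf)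
  \<comment> \<open>The tangent inequality is applied to \<open>x i * x j\<close> and
    \<open>w i * w j\<close>, whose logarithms differ by \<open>d i + d j\<close>.\<close>
  have "(\<Sum>j<n. \<Sum>i<j. (d i + d j) * (y i * y j))
      \<le> (\<Sum>j<n. \<Sum>i<j. 1 / (w i * w j) - 1 / (x i * x j))"
  proof (intro sum_mono)
    fix j i assume "j \<in> {..<n}" "i \<in> {..<j}"
    then have "x i > 0" "x j > 0" "w i > 0" "w j > 0"
      using x w by auto
    then show "(d i + d j) * (y i * y j) \<le> 1 / (w i * w j) - 1 / (x i * x j)"
      using inverse_diff_ge_ln[of "x i * x j" "w i * w j"]
      by (simp add: d_def y_def ln_mult algebra_simps)
  qed
  then have 2: "(\<Sum>i<n. d i * (y i * (s - y i))) \<le> recip_pairs w n - recip_pairs x n"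
    unfolding pair_sum_rearrange s_def[symmetric] by (simp add: pairs sum_subtractf)
  have "(\<Sum>i<n. d i * (y i * (C + s - y i)))
      = C * (\<Sum>i<n. d i * y i) + (\<Sum>i<n. d i * (y i * (s - y i)))"
    by (simp add: sum_distrib_left sum.distrib[symmetric] algebra_simps)
  also have "\<dots> \<le> C * (recip_sum w n - recip_sum x n) + (recip_pairs w n - recip_pairs x n)"
    using 1 2 \<open>C \<ge> 0\<close> by (intro add_mono mult_left_mono)
  finally show ?thesis
    using grad by (simp add: algebra_simps)
qed

subsection \<open>The extremal sequence\<close>

text \<open>The sequence is re-indexed from \<open>0\<close>, so that its first \<open>n\<close> terms are those below \<open>n\<close>.\<close>

definition vs :: "nat \<Rightarrow> real" where
  "vs i = vseq (Suc i)"

text \<open>The one recursion also yields both initial values: empty sums give 1, and a single term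
  gives 2.\<close>

lemma vs_rec: "vs n = 1 + recip_sum vs n / (1 - recip_pairs vs n)"
proof -
  have S: "recip_sum vs k = (\<Sum>i=1..k. 1 / vseq i)" for k
    by (induction k) (simp_all add: vs_def)
  have S': "recip_sum vs k = (\<Sum>i=1..<Suc k. 1 / vseq i)" for k
    by (induction k) (simp_all add: vs_def)
  have E: "recip_pairs vs k = (\<Sum>j=1..k. \<Sum>i=1..<j. 1 / (vseq i * vseq j))" for k
  proof (induction k)
    case (Suc k)
    have "recip_sum vs k / vs k = (\<Sum>i=1..<Suc k. 1 / (vseq i * vseq (Suc k)))"
      unfolding S' by (simp only: vs_def sum_divide_distrib divide_divide_eq_left)
    with Suc show ?case by (simp only: recip_pairs_Suc sum.cl_ivl_Suc) simp
  qed simp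
  consider "n = 0" | "n = 1" | "n \<ge> 2" by linarith
  then show ?thesis
  proof cases
    case 3
    then show ?thesis
      using vseq_rec[of n] unfolding S E by (simp add: vs_def)
  qed (simp_all add: vs_def)
qed

text \<open>With gap \<open>1 / P\<close> the recursion reads \<open>v = 1 + S * P\<close>, so the
  next gap is \<open>(v - S * P) / (P * v) = 1 / (P * v)\<close>. The lower bound on the terms is
  carried along to keep the divisions legitimate.\<close>

lemma vs_gap: "(\<forall>i<n. vs i \<ge> 1) \<and> 1 - recip_pairs vs n = 1 / partial_prod vs n"
proof (induction n)
  case (Suc n)
  then have IH: "vs i \<ge> 1" if "i < n" for i
    using that by blast
  have P: "partial_prod vs n > 0"
    using IH by (intro partial_prod_pos) (auto intro: order_less_le_trans[of _ 1])
  have S: "recip_sum vs n \<ge> 0"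
    using IH by (intro recip_sum_nonneg) (auto intro: order_less_le_trans[of _ 1])
  have wn: "vs n = 1 + recip_sum vs n * partial_prod vs n"
    using vs_rec[of n] Suc.IH by simp
  then have "vs n \<ge> 1" using P S by simp
  moreover have "1 - recip_pairs vs (Suc n) = 1 / partial_prod vs (Suc n)"
  proof -
    have "1 - recip_pairs vs (Suc n) = 1 / partial_prod vs n - recip_sum vs n / vs n"
      using Suc.IH by (simp add: algebra_simps)
    also have "\<dots> = (vs n - recip_sum vs n * partial_prod vs n) / (partial_prod vs n * vs n)"
      using P \<open>vs n \<ge> 1\<close> by (simp add: field_simps)
    also have "\<dots> = 1 / partial_prod vs (Suc n)"
      using wn by simp
    finally show ?thesis .
  qed
  ultimately show ?case
    using Suc.IH less_Suc_eq by auto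
qed simp

lemma vs_ge_1: "vs i \<ge> 1"
  using vs_gap[of "Suc i"] by simp

lemma vs_pos: "vs i > 0"
  using vs_ge_1[of i] by simp

lemma recip_pairs_vs: "recip_pairs vs n = 1 - 1 / partial_prod vs n"
  using vs_gap[of n] by linarith

lemma partial_prod_vs_pos: "partial_prod vs n > 0"
  by (intro partial_prod_pos vs_pos)

lemma vs_eq: "vs n = 1 + recip_sum vs n * partial_prod vs n"
  using vs_rec[of n] vs_gap[of n] by simp

lemma vs_Ints: "vs n \<in> \<int>"
proof (induction n rule: less_induct)
  case (less n)
  have "partial_prod vs n * recip_sum vs n \<in> \<int>"
    using less by (intro recip_prod_Ints vs_pos)
  then show ?case
    by (subst vs_eq) (auto simp: mult.commute)
qed

text \<open>The reciprocal sum is eliminated through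
  \<open>recip_sum vs n * partial_prod vs n = vs n - 1\<close>.\<close>

lemma vs_Suc: "vs (Suc n) = (vs n)\<^sup>2 - vs n + 1 + partial_prod vs n"
proof -
  have "vs (Suc n) = 1 + (recip_sum vs n * partial_prod vs n) * vs n + partial_prod vs n"
    using vs_pos[of n] by (subst vs_eq) (simp add: field_simps)
  also have "recip_sum vs n * partial_prod vs n = vs n - 1"
    using vs_eq[of n] by simp
  finally show ?thesis
    by (simp add: power2_eq_square algebra_simps)
qed

lemma vs_small: "vs 0 = 1" "vs (Suc 0) = 2" "vs 2 = 4"
  by (simp_all add: vs_def numeral_2_eq_2 lessThan_Suc numeral_3_eq_3 atLeastAtMostSuc_conv 
      sum.atLeastLessThan_Suc)

lemma partial_prod_vs_mono:
  assumes "i \<le> j"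
  shows "partial_prod vs i \<le> partial_prod vs j"
proof (rule lift_Suc_mono_le[OF _ assms])
  show "partial_prod vs n \<le> partial_prod vs (Suc n)" for n
    using vs_ge_1[of n] partial_prod_vs_pos[of n] mult_left_mono[of 1 "vs n" "partial_prod vs n"]
    by simp
qed

lemma vs_from_2:
  assumes "n \<ge> 2"
  shows "recip_sum vs n \<ge> 3 / 2" "partial_prod vs n \<ge> 2"
proof -
  have "recip_sum vs 2 \<le> recip_sum vs n" "partial_prod vs 2 \<le> partial_prod vs n"
    using assms vs_pos by (auto intro: recip_mono partial_prod_vs_mono)
  then show "recip_sum vs n \<ge> 3 / 2" "partial_prod vs n \<ge> 2"
    by (simp_all add: numeral_2_eq_2 vs_small)
qed

section \<open>Extremality of the sequence among integer sequences\<close>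

lemma Ints_less_imp_add1_le:
  fixes a b :: real
  assumes "a \<in> \<int>" "b \<in> \<int>" "a < b"
  shows "a + 1 \<le> b"
proof -
  obtain k l where kl: "a = of_int k" "b = of_int l"
    using assms by (auto elim!: Ints_cases)
  then have "k + 1 \<le> l" using assms by simp
  then have "of_int (k + 1) \<le> (of_int l :: real)" by (subst of_int_le_iff)
  then show ?thesis using kl by simp
qed

text \<open>
  Let \<open>i\<close> be the first index at which \<open>x\<close> and \<open>vs\<close> differ. Then \<open>x i \<ge> vs i + 1\<close>, and the tail
  of reciprocals from \<open>i\<close> on is below \<open>1 / (vs i - 1)\<close>, so its squares sum to at most
  \<open>1 / ((vs i)\<^sup>2 - 1)\<close>, which is no more than the first two squares of the
  tail of \<open>vs\<close> once \<open>i \<ge> 2\<close>. For \<open>i < 2\<close> the quadratic identity bounds the tail instead.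
\<close>

lemma recip_squares_le_vs:
  assumes int: "\<And>i. i < k \<Longrightarrow> x i \<in> \<int>" and ge1: "\<And>i. i < k \<Longrightarrow> 1 \<le> x i"
    and sorted: "\<And>i j. i \<le> j \<Longrightarrow> j < k \<Longrightarrow> x i \<le> x j"
    and E: "recip_pairs x k < 1"
  shows "recip_squares x k \<le> recip_squares vs k"
proof (cases "\<forall>i<k. x i = vs i")
  case True
  then show ?thesis using recip_cong(3)[of k x vs] by simp
next
  case False
  define i where "i = (LEAST i. i < k \<and> x i \<noteq> vs i)"
  have i: "i < k" "x i \<noteq> vs i"
    using LeastI_ex[of "\<lambda>i. i < k \<and> x i \<noteq> vs i"] False by (auto simp: i_def)
  have before: "x j = vs j" if "j < i" for j
    using not_less_Least[of j "\<lambda>i. i < k \<and> x i \<noteq> vs i"] that i(1) by (auto simp: i_def)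
  note same = recip_cong[of i x vs, OF before]
  obtain m where m: "k = i + Suc m"
    using i(1) less_iff_Suc_add by auto
  define x' w' where "x' = (\<lambda>l. x (i + l))" and "w' = (\<lambda>l. vs (i + l))"
  define t q e where "t = recip_sum x' (Suc m)" and "q = recip_squares x' (Suc m)"
    and "e = recip_pairs x' (Suc m)"
  define S P V where "S = recip_sum vs i" and "P = partial_prod vs i" and "V = vs i"
  have x'_pos: "x' l > 0" if "l < Suc m" for l
    using ge1[of "i + l"] that m by (simp add: x'_def)
  have P: "P > 0" and V: "V = 1 + S * P" "V \<ge> 1" and S: "S \<ge> 0"
    using partial_prod_vs_pos vs_eq[of i] vs_ge_1[of i] vs_pos recip_sum_nonneg[of i vs]
    by (auto simp: P_def V_def S_def)
  have "recip_pairs x k = recip_pairs vs i + S * t + e"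
    unfolding m recip_pairs_add by (simp add: same S_def t_def e_def x'_def)
  then have tail: "S * t + e < 1 / P"
    using E recip_pairs_vs[of i] by (simp add: P_def)
  have e: "e \<ge> 0" and t: "t \<ge> 0" and t_sq: "t\<^sup>2 = q + 2 * e"
    unfolding e_def t_def q_def
    using x'_pos by (simp_all only: recip_pairs_nonneg recip_sum_nonneg recip_sum_square)
  have St: "S * t < 1 / P" using tail e by simp
  \<comment> \<open>The bound on \<open>S * t\<close> forces \<open>x i > S * P = V - 1\<close>. By
    integrality \<open>x i \<ge> V\<close>, and as the two differ,
    \<open>x i \<ge> V + 1\<close>.\<close>
  have "1 / x i \<le> t"
    using recip_mono(1)[of 1 "Suc m" x'] x'_pos by (simp add: t_def x'_def)
  then have "S * (1 / x i) < 1 / P"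
    using S St by (meson mult_left_mono order_le_less_trans)
  then have "V < x i + 1"
    using V P x'_pos[of 0] by (simp add: x'_def field_simps)
  then have "V \<le> x i"
    using Ints_less_imp_add1_le[of V "x i + 1"] vs_Ints[of i] int[OF i(1)] by (simp add: V_def)
  then have xi: "V + 1 \<le> x i"
    using Ints_less_imp_add1_le[of V "x i"] vs_Ints[of i] int[OF i(1)] i(2) by (simp add: V_def)
  have x'_ge: "V + 1 \<le> x' l" if "l < Suc m" for l
    using sorted[of i "i + l"] that m xi by (simp add: x'_def)
  have q: "q \<le> t / (V + 1)"
    unfolding q_def t_def using V(2) x'_ge by (intro recip_squares_le_recip_sum) auto
  have w1: "1 / V\<^sup>2 \<le> recip_squares w' (Suc m)"
    using recip_mono(3)[of 1 "Suc m" w'] vs_pos by (simp add: w'_def V_def)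
  have "q \<le> recip_squares w' (Suc m)"
  proof (cases m)
    case 0
    have "1 / (x i)\<^sup>2 \<le> 1 / V\<^sup>2"
      using xi V(2) by (intro frac_le power_mono) auto
    then show ?thesis using w1 0 by (simp add: q_def x'_def)
  next
    case (Suc m')
    have w2: "1 / V\<^sup>2 + 1 / (vs (Suc i))\<^sup>2 \<le> recip_squares w' (Suc m)"
      using recip_mono(3)[of 2 "Suc m" w'] vs_pos Suc by (simp add: w'_def V_def numeral_2_eq_2)
    consider "i = 0" | "i = 1" | "i \<ge> 2" by linarith
    then show ?thesis
    proof cases
      case 1
      then have "V = 1" "P = 1" "S = 0" by (simp_all add: V_def P_def S_def vs_small)
      \<comment> \<open>Since \<open>q \<le> t / 2\<close>, this brings \<open>q\<close> below the
        first square of the tail of \<open>vs\<close>, which is 1.\<close>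
      have "t < 2"
      proof (rule ccontr)
        assume "\<not> t < 2"
        then have "t * 2 \<le> t * t" by (intro mult_left_mono) auto
        moreover have "t\<^sup>2 < t / 2 + 2"
          using t_sq q tail \<open>V = 1\<close> \<open>P = 1\<close> \<open>S = 0\<close> by simp
        ultimately show False using \<open>\<not> t < 2\<close> unfolding power2_eq_square by linarith
      qed
      then show ?thesis using q w1 \<open>V = 1\<close> by simp
    next
      case 2
      then have "V = 2" "P = 1" "S = 1" by (simp_all add: V_def P_def S_def vs_small)
      \<comment> \<open>The terms 2 and 4 of \<open>vs\<close> contribute
        \<open>1 / 4 + 1 / 16 = 5 / 16\<close>, and \<open>q \<le> t / 3\<close>; hence the
        threshold \<open>15 / 16\<close>.\<close>
      have "t < 15 / 16"
      proof (rule ccontr)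
        assume "\<not> t < 15 / 16"
        then have "(15 / 16) * (15 / 16) \<le> t * t" by (intro mult_mono) auto
        moreover have "t\<^sup>2 < t / 3 + 2 * (1 - t)"
          using t_sq q tail \<open>V = 2\<close> \<open>P = 1\<close> \<open>S = 1\<close> by simp
        ultimately show False using \<open>\<not> t < 15 / 16\<close> by (simp add: power2_eq_square)
      qed
      then show ?thesis using q w2 \<open>V = 2\<close> 2 vs_small(3) by (simp add: numeral_2_eq_2)
    next
      case 3
      have S: "S \<ge> 3 / 2" and P2: "P \<ge> 2"
        using vs_from_2[OF 3] by (auto simp: S_def P_def)
      have "3 / 2 * P \<le> S * P"
        using S P by (intro mult_right_mono) auto
      \<comment> \<open>This makes \<open>V' \<le> V\<^sup>2 - 1\<close>; the partial fraction
        identity below then gives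
        \<open>1 / V\<^sup>2 + 1 / V'\<^sup>2 \<ge> 1 / (V\<^sup>2 - 1)\<close>.\<close>
      then have V2: "V \<ge> P + 2" using V(1) P2 by linarith
      define V' where "V' = vs (Suc i)"
      have V': "V' = V\<^sup>2 - V + 1 + P" "V' > 0"
        unfolding V'_def V_def P_def by (rule vs_Suc vs_pos)+
      have "V * V \<ge> 4 * 4" using V2 P2 by (intro mult_mono) auto
      then have VV: "V\<^sup>2 \<ge> 16" by (simp add: power2_eq_square)
      have "V'\<^sup>2 \<le> (V\<^sup>2 - 1)\<^sup>2"
        using V' V2 by (intro power_mono) auto
      also have "\<dots> \<le> V\<^sup>2 * (V\<^sup>2 - 1)"
        unfolding power2_eq_square[of "V\<^sup>2 - 1"] using VV by (intro mult_right_mono) auto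
      finally have "1 / (V\<^sup>2 * (V\<^sup>2 - 1)) \<le> 1 / V'\<^sup>2"
        using V'(2) VV V(2) by (intro divide_left_mono mult_pos_pos) auto
      moreover have "1 / (a * (a - 1)) = 1 / (a - 1) - 1 / a" if "a \<ge> 16" for a :: real
        using that by (simp add: field_simps)
      note this[OF VV]
      moreover have "t / (V + 1) \<le> 1 / (V\<^sup>2 - 1)"
      proof -
        have "t * (V - 1) \<le> 1"
          using St V(1) P by (simp add: field_simps)
        then have "t \<le> 1 / (V - 1)"
          using V2 P2 by (simp add: field_simps)
        then have "t / (V + 1) \<le> 1 / (V - 1) / (V + 1)"
          using V2 P2 by (intro divide_right_mono) auto
        also have "\<dots> = 1 / (V\<^sup>2 - 1)"
          by (simp add: power2_eq_square algebra_simps)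
        finally show ?thesis .
      qed
      ultimately show ?thesis using q w2 by (simp add: V'_def)
    qed
  qed
  then show ?thesis
    unfolding m recip_squares_add by (simp add: same q_def x'_def w'_def)
qed

lemma recip_sum_le_vs_of_recip_pairs_le:
  assumes "recip_squares x k \<le> recip_squares vs k" "recip_pairs x k \<le> recip_pairs vs k"
  shows "recip_sum x k \<le> recip_sum vs k"
proof (rule power2_le_imp_le)
  show "(recip_sum x k)\<^sup>2 \<le> (recip_sum vs k)\<^sup>2"
    using assms by (simp add: recip_sum_square)
qed (simp add: recip_sum_nonneg vs_pos)

text \<open>
  If the product of \<open>x\<close> is at most that of \<open>vs\<close>, integrality of the product times the gap gives
  the bound. Otherwise split at the last \<open>j\<close> where the product of \<open>x\<close> is at most that of \<open>vs\<close>: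
  the prefix is covered by induction, and the partial products of the tail dominate those of
  the tail of \<open>vs\<close>.
\<close>

lemma recip_pairs_le_vs:
  assumes "\<And>i. i < k \<Longrightarrow> x i \<in> \<int>" "\<And>i. i < k \<Longrightarrow> 1 \<le> x i"
    and "\<And>i j. i \<le> j \<Longrightarrow> j < k \<Longrightarrow> x i \<le> x j" and "recip_pairs x k < 1"
  shows "recip_pairs x k \<le> recip_pairs vs k"
  using assms
proof (induction k rule: less_induct)
  case (less k)
  have pos: "x i > 0" if "i < k" for i
    using less.prems(2)[OF that] by simp
  define J where "J = {j. j \<le> k \<and> partial_prod x j \<le> partial_prod vs j}"
  have J: "finite J" "0 \<in> J" by (auto simp: J_def)
  define j where "j = Max J"
  have "j \<in> J"
    unfolding j_def using J by (intro Max_in) auto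
  then have j: "j \<le> k" "partial_prod x j \<le> partial_prod vs j"
    by (auto simp: J_def)
  have above: "partial_prod vs i < partial_prod x i" if "j < i" "i \<le> k" for i
  proof -
    have "i \<notin> J"
      using Max_ge[OF J(1), of i] that(1) unfolding j_def by linarith
    then show ?thesis using that(2) by (simp add: J_def)
  qed
  show ?case
  proof (cases "j = k")
    case True
    \<comment> \<open>\<open>vs\<close> attains the integrality bound on the gap with equality, so a
      smaller product of \<open>x\<close> forces a gap at least as large.\<close>
    have "1 / partial_prod vs k \<le> 1 / partial_prod x k"
      using j True pos by (intro divide_left_mono) (auto intro!: mult_pos_pos partial_prod_pos vs_pos)
    also have "\<dots> \<le> 1 - recip_pairs x k"
      using less.prems pos by (intro recip_pairs_gap)
    finally show ?thesis by (simp add: recip_pairs_vs)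
  next
    case False
    obtain m where m: "k = j + m"
      using j(1) le_Suc_ex by blast
    have "recip_pairs x j < 1"
      using recip_mono(2)[of j k x] j(1) pos less.prems(4) by simp
    then have Ej: "recip_pairs x j \<le> recip_pairs vs j"
      using less.prems j(1) False by (intro less.IH) auto
    \<comment> \<open>Pairs across the cut at \<open>j\<close> are weighted by the prefix sum, so
      the prefixes must be compared in their sums as well.\<close>
    have Sj: "recip_sum x j \<le> recip_sum vs j"
      using less.prems j(1) \<open>recip_pairs x j < 1\<close> Ej
      by (intro recip_sum_le_vs_of_recip_pairs_le recip_squares_le_vs) auto
    define x' w' where "x' = (\<lambda>l. x (j + l))" and "w' = (\<lambda>l. vs (j + l))"
    have x': "x' l > 0" if "l < m" for l
      using that pos m by (simp add: x'_def)
    \<comment> \<open>Up to \<open>j\<close> the product of \<open>x\<close> is at most that of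
      \<open>vs\<close>, beyond \<open>j\<close> it is larger; cancelling the prefixes leaves
      domination of the tails.\<close>
    have "partial_prod w' l \<le> partial_prod x' l" if "l \<le> m" for l
    proof (cases "l = 0")
      case l: False
      have xj: "partial_prod x j > 0"
        using pos j(1) by (intro partial_prod_pos) auto
      have w'p: "partial_prod w' l > 0"
        by (intro partial_prod_pos) (simp add: w'_def vs_pos)
      have "partial_prod x j * partial_prod w' l \<le> partial_prod vs j * partial_prod w' l"
        using j(2) w'p by (intro mult_right_mono) auto
      also have "\<dots> \<le> partial_prod x j * partial_prod x' l"
        using above[of "j + l"] l that m by (simp add: partial_prod_add x'_def w'_def)
      finally show ?thesis using xj by simp
    qed simp
    \<comment> \<open>Taking the prefix sum of \<open>vs\<close> as the constant \<open>C\<close>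
      includes the cross pairs in the convexity comparison.\<close>
    then have "recip_sum vs j * recip_sum x' m + recip_pairs x' m
        \<le> recip_sum vs j * recip_sum w' m + recip_pairs w' m"
      using x' less.prems(3) m
      by (intro recip_le_of_partial_prod_ge) (auto simp: x'_def w'_def vs_pos recip_sum_nonneg)
    moreover have "recip_sum x j * recip_sum x' m \<le> recip_sum vs j * recip_sum x' m"
      using Sj x' by (intro mult_right_mono recip_sum_nonneg)
    ultimately show ?thesis
      using Ej unfolding m recip_pairs_add x'_def w'_def by linarith
  qed
qed

subsection \<open>The divisor bound\<close>

definition num_divisors :: "nat \<Rightarrow> nat" where
  "num_divisors n = card {d. d dvd n}"

text \<open>Every divisor is \<open>p ^ i * e\<close> with \<open>i \<le> a\<close> and
  \<open>e\<close> dividing \<open>m\<close>, which leaves \<open>a + 1\<close> choices for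
  \<open>i\<close>.\<close>

lemma num_divisors_prime_power_mult:
  fixes p a m :: nat
  assumes "prime p" "m > 0"
  shows "num_divisors (p ^ a * m) \<le> (a + 1) * num_divisors m"
proof -
  have fin: "finite {d. d dvd m}" using assms(2) by simp
  have "{d. d dvd p ^ a * m} \<subseteq> (\<lambda>(i, e). p ^ i * e) ` ({..a} \<times> {d. d dvd m})"
  proof
    fix d assume "d \<in> {d. d dvd p ^ a * m}"
    then obtain b c where "d = b * c" "b dvd p ^ a" "c dvd m"
      using division_decomp by blast
    then show "d \<in> (\<lambda>(i, e). p ^ i * e) ` ({..a} \<times> {d. d dvd m})"
      using divides_primepow_nat[OF assms(1)] by force
  qed
  then have "num_divisors (p ^ a * m) \<le> card ((\<lambda>(i, e). p ^ i * e) ` ({..a} \<times> {d. d dvd m}))"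
    unfolding num_divisors_def using fin by (intro card_mono) auto
  also have "\<dots> \<le> card ({..a} \<times> {d. d dvd m})"
    using fin by (intro card_image_le) auto
  finally show ?thesis
    by (simp add: card_cartesian_product num_divisors_def)
qed

text \<open>
  Each prime power \<open>p ^ a\<close> contributes a factor \<open>(a + 1) / p powr (a * \<delta>)\<close>, which is at most
  \<open>c\<close>, and at most \<open>1\<close> unless \<open>p < 2 powr (1 / \<delta>)\<close>.
\<close>

lemma num_divisors_bound:
  fixes \<delta> :: real
  assumes "\<delta> > 0"
  obtains C :: real where "C \<ge> 1" "\<And>n. n > 0 \<Longrightarrow> num_divisors n \<le> C * real n powr \<delta>"
proof -
  \<comment> \<open>Numbers \<open>p \<ge> K\<close> satisfy \<open>p powr \<delta> \<ge> 2\<close>,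
    and \<open>a + 1 \<le> 2 ^ a\<close>. The constant \<open>c\<close> is chosen so that
    \<open>1 + a \<le> c * (1 + a * (\<delta> * ln 2))\<close>, where the bracket is at most
    \<open>(2 ^ a) powr \<delta>\<close>.\<close>
  define K where "K = nat \<lceil>2 powr (1 / \<delta>)\<rceil>"
  define c where "c = 1 / min 1 (\<delta> * ln 2)"
  have pos: "min 1 (\<delta> * ln 2) > 0" using assms by simp
  have c: "c \<ge> 1" unfolding c_def using pos by simp
  have small: "real (a + 1) \<le> c * (real p ^ a) powr \<delta>" if "p \<ge> 2" for p a :: nat
  proof -
    have "(1 + real a) * min 1 (\<delta> * ln 2) \<le> 1 + real a * (\<delta> * ln 2)"
      using mult_left_mono[of "min 1 (\<delta> * ln 2)" "\<delta> * ln 2" "real a"] by (simp add: distrib_right)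
    also have "\<dots> \<le> exp (real a * (\<delta> * ln 2))"
      by (rule exp_ge_add_one_self)
    also have "\<dots> = (2 ^ a) powr \<delta>"
      by (simp add: powr_def ln_realpow mult_ac)
    also have "\<dots> \<le> (real p ^ a) powr \<delta>"
      using assms that by (intro powr_mono2 power_mono) auto
    finally show ?thesis
      using pos by (simp add: c_def field_simps)
  qed
  have large: "real (a + 1) \<le> (real p ^ a) powr \<delta>" if "p \<ge> K" for p a :: nat
  proof -
    have "2 powr (1 / \<delta>) \<le> real p"
      using that unfolding K_def by linarith
    then have "(2 powr (1 / \<delta>)) powr \<delta> \<le> real p powr \<delta>"
      using assms by (intro powr_mono2) auto
    then have 2: "2 \<le> real p powr \<delta>"
      using assms by (simp add: powr_powr)
    have "p > 0" using 2 by (cases "p = 0") auto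
    have "a + 1 \<le> 2 ^ a"
      by (induction a) auto
    then have "real (a + 1) \<le> 2 ^ a"
      by (metis of_nat_le_iff of_nat_numeral of_nat_power)
    also have "\<dots> \<le> (real p powr \<delta>) ^ a"
      using 2 by (intro power_mono) auto
    also have "\<dots> = (real p ^ a) powr \<delta>"
      using \<open>p > 0\<close> by (simp add: powr_powr powr_realpow[symmetric] mult_ac)
    finally show ?thesis .
  qed
  \<comment> \<open>The induction strips off the full power of one prime at a time and charges a
    factor \<open>c\<close> only for primes below \<open>K\<close>, of which there are at most
    \<open>K\<close>.\<close>
  have main: "num_divisors n \<le> c ^ card (prime_factors n \<inter> {..<K}) * real n powr \<delta>" if "n > 0" for n
    using that
  proof (induction n rule: less_induct)
    case (less n)
    show ?case
    proof (cases "n = 1")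
      case True
      then show ?thesis by (simp add: num_divisors_def)
    next
      case False
      then obtain p where p: "prime p" "p dvd n"
        using prime_factor_nat by blast
      define a where "a = multiplicity p n"
      obtain m where m: "n = p ^ a * m" "\<not> p dvd m"
        using multiplicity_decompose'[of n p] less.prems p unfolding a_def
        by (metis not_prime_unit gr_implies_not_zero)
      have "a > 0" using p less.prems by (simp add: a_def prime_multiplicity_gt_zero_iff)
      have "m > 0" using m less.prems by (cases "m = 0") auto
      have "1 < p ^ a" using \<open>a > 0\<close> p(1) by (intro one_less_power prime_gt_1_nat)
      then have "m < n" using \<open>m > 0\<close> m(1) by simp
      define F where "F k = prime_factors k \<inter> {..<K}" for k
      have fin: "finite (F k)" for k by (simp add: F_def)
      have pf: "prime_factors n = insert p (prime_factors m)"
        using m(1) p(1) \<open>a > 0\<close> \<open>m > 0\<close>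
        by (simp add: prime_factors_product prime_factorization_prime_power)
      have "p \<notin> prime_factors m" using m(2) by auto
      have "real (a + 1) \<le> c ^ (card (F n) - card (F m)) * (real p ^ a) powr \<delta>
          \<and> card (F m) \<le> card (F n)"
      proof (cases "p < K")
        case True
        then have "F n = insert p (F m)" "p \<notin> F m"
          using pf \<open>p \<notin> prime_factors m\<close> by (auto simp: F_def)
        then show ?thesis
          using small[of p a] prime_ge_2_nat[OF p(1)] fin[of m] by simp
      next
        case False
        then have "F n = F m" using pf by (auto simp: F_def)
        then show ?thesis using large[of p a] False by simp
      qed
      note a = conjunct1[OF this] and cards = conjunct2[OF this]
      have "real (num_divisors n) \<le> real (a + 1) * real (num_divisors m)"
        using num_divisors_prime_power_mult[OF p(1) \<open>m > 0\<close>, of a] m(1)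
        by (metis of_nat_le_iff of_nat_mult)
      also have "\<dots> \<le> (c ^ (card (F n) - card (F m)) * (real p ^ a) powr \<delta>) *
          (c ^ card (F m) * real m powr \<delta>)"
        using a less.IH[OF \<open>m < n\<close> \<open>m > 0\<close>] c
        by (intro mult_mono) (auto simp: F_def)
      also have "\<dots> = (c ^ (card (F n) - card (F m)) * c ^ card (F m)) *
          ((real p ^ a) powr \<delta> * real m powr \<delta>)"
        by simp
      also have "\<dots> = c ^ card (F n) * real n powr \<delta>"
        using cards m(1) by (simp add: power_add[symmetric] powr_mult[symmetric])
      finally show ?thesis by (simp add: F_def)
    qed
  qed
  show ?thesis
  proof (rule that[of "c ^ K"])
    fix n :: nat assume "n > 0"
    have "card (prime_factors n \<inter> {..<K}) \<le> K"
      using card_mono[of "{..<K}" "prime_factors n \<inter> {..<K}"] by simp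
    then have "c ^ card (prime_factors n \<inter> {..<K}) \<le> c ^ K"
      using c by (intro power_increasing)
    then show "num_divisors n \<le> c ^ K * real n powr \<delta>"
      using main[OF \<open>n > 0\<close>] by (meson mult_right_mono order_trans powr_ge_zero)
  qed (use c in simp)
qed

subsection \<open>Counting solutions\<close>

lemma sigma_0: "sigma 0 xs = 1"
proof -
  have "{I. I \<subseteq> {..<length xs} \<and> card I = 0} = {{}}"
    by (auto dest: finite_subset)
  then show ?thesis by (simp add: sigma_def)
qed

lemma sigma_eq_0:
  assumes "length xs < j"
  shows "sigma j xs = 0"
proof -
  have "card I \<noteq> j" if "I \<subseteq> {..<length xs}" for I
    using card_mono[OF _ that] assms by auto
  then show ?thesis unfolding sigma_def by (intro sum.neutral) auto
qed

text \<open>Index sets are split according to whether they contain the last position.\<close>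

lemma sigma_snoc: "sigma (Suc j) (xs @ [y]) = sigma (Suc j) xs + y * sigma j xs"
proof -
  define L where "L = length xs"
  define A where "A k = {I. I \<subseteq> {..<L} \<and> card I = k}" for k
  have fin: "finite (A k)" for k
    unfolding A_def by (rule finite_subset[of _ "Pow {..<L}"]) auto
  have notin: "L \<notin> I" and finI: "finite I" if "I \<in> A k" for I k
    using that finite_subset by (auto simp: A_def)
  have split: "{I. I \<subseteq> {..<Suc L} \<and> card I = Suc j} = A (Suc j) \<union> insert L ` A j"
  proof (intro equalityI subsetI)
    fix I assume I: "I \<in> {I. I \<subseteq> {..<Suc L} \<and> card I = Suc j}"
    then have fin: "finite I" using finite_subset by blast
    show "I \<in> A (Suc j) \<union> insert L ` A j"
    proof (cases "L \<in> I")
      case True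
      then have "I = insert L (I - {L})" "I - {L} \<in> A j"
        using I fin by (auto simp: A_def less_Suc_eq)
      then show ?thesis by blast
    next
      case False
      then show ?thesis using I by (auto simp: A_def less_Suc_eq)
    qed
  next
    fix I assume "I \<in> A (Suc j) \<union> insert L ` A j"
    then consider "I \<in> A (Suc j)" | J where "I = insert L J" "J \<in> A j" by blast
    then show "I \<in> {I. I \<subseteq> {..<Suc L} \<and> card I = Suc j}"
    proof cases
      case 1
      then show ?thesis by (auto simp: A_def)
    next
      case (2 J)
      then show ?thesis
        using notin[OF 2(2)] finI[OF 2(2)] by (auto simp: A_def)
    qed
  qed
  have inj: "inj_on (insert L) (A j)"
  proof (rule inj_onI)
    fix I J assume IJ: "I \<in> A j" "J \<in> A j" "insert L I = insert L J"
    show "I = J"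
      using IJ(3) insert_ident[OF notin[OF IJ(1)] notin[OF IJ(2)]] by simp
  qed
  have 1: "(\<Prod>i\<in>I. (xs @ [y]) ! i) = (\<Prod>i\<in>I. xs ! i)" if "I \<in> A k" for I k
    using that by (intro prod.cong) (auto simp: A_def L_def nth_append)
  have 2: "(\<Prod>i\<in>insert L I. (xs @ [y]) ! i) = y * (\<Prod>i\<in>I. xs ! i)" if "I \<in> A j" for I
    using 1[OF that] notin[OF that] finI[OF that] by (simp add: L_def)
  have "sigma (Suc j) (xs @ [y]) =
      (\<Sum>I\<in>A (Suc j). \<Prod>i\<in>I. (xs @ [y]) ! i) + (\<Sum>I\<in>insert L ` A j. \<Prod>i\<in>I. (xs @ [y]) ! i)"
    unfolding sigma_def length_append_singleton L_def[symmetric] split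
    using fin notin by (intro sum.union_disjoint) auto
  also have "\<dots> = (\<Sum>I\<in>A (Suc j). \<Prod>i\<in>I. xs ! i) + (\<Sum>I\<in>A j. y * (\<Prod>i\<in>I. xs ! i))"
    using 1 2 by (simp add: sum.reindex[OF inj] cong: sum.cong)
  finally show ?thesis
    by (simp add: sigma_def A_def L_def sum_distrib_left)
qed

section \<open>Solutions in terms of reciprocals\<close>

definition entries :: "int list \<Rightarrow> nat \<Rightarrow> real" where
  "entries xs i = of_int (xs ! i)"

text \<open>Passing to complements of index sets turns degree \<open>n - j\<close> in the entries
  into degree \<open>j\<close> in the reciprocals, times the product. The cases
  \<open>j = 0, 1, 2\<close> are proved together, since appending an entry links each to the one
  before.\<close>

lemma sigma_eq_recip:
  assumes "\<forall>x\<in>set xs. x \<noteq> 0"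
  shows "of_int (sigma (length xs) xs) = partial_prod (entries xs) (length xs)"
    and "length xs = Suc k \<Longrightarrow> of_int (sigma k xs) =
      partial_prod (entries xs) (length xs) * recip_sum (entries xs) (length xs)"
    and "length xs = Suc (Suc k) \<Longrightarrow> of_int (sigma k xs) =
      partial_prod (entries xs) (length xs) * recip_pairs (entries xs) (length xs)"
proof -
  have "of_int (sigma (length xs) xs) = partial_prod (entries xs) (length xs) \<and>
    (\<forall>k. length xs = Suc k \<longrightarrow> of_int (sigma k xs) =
      partial_prod (entries xs) (length xs) * recip_sum (entries xs) (length xs)) \<and>
    (\<forall>k. length xs = Suc (Suc k) \<longrightarrow> of_int (sigma k xs) =
      partial_prod (entries xs) (length xs) * recip_pairs (entries xs) (length xs))"
    using assms
  proof (induction xs rule: rev_induct)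
    case Nil
    then show ?case by (simp add: sigma_0)
  next
    case (snoc y xs)
    define L P S E where "L = length xs" and "P = partial_prod (entries xs) L"
      and "S = recip_sum (entries xs) L" and "E = recip_pairs (entries xs) L"
    have IH: "of_int (sigma L xs) = P" "\<And>k. L = Suc k \<Longrightarrow> of_int (sigma k xs) = P * S"
      "\<And>k. L = Suc (Suc k) \<Longrightarrow> of_int (sigma k xs) = P * E"
      using snoc by (auto simp: L_def P_def S_def E_def)
    have y: "y \<noteq> 0" using snoc.prems by simp
    have eL: "entries (xs @ [y]) L = of_int y"
      by (simp add: entries_def L_def)
    have "entries (xs @ [y]) i = entries xs i" if "i < L" for i
      using that by (simp add: entries_def L_def nth_append)
    note cong = recip_cong[of L, OF this]
    have 1: "of_int (sigma (Suc L) (xs @ [y])) = P * of_int y"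
      using IH(1) by (simp add: sigma_snoc sigma_eq_0 L_def)
    have 2: "of_int (sigma L (xs @ [y])) = P * of_int y * (S + 1 / of_int y)"
    proof (cases L)
      case 0
      then show ?thesis using y by (simp add: sigma_0 P_def S_def)
    next
      case (Suc l)
      then show ?thesis using IH y by (simp add: sigma_snoc distrib_left)
    qed
    have 3: "of_int (sigma k (xs @ [y])) = P * of_int y * (E + S / of_int y)" if k: "L = Suc k" for k
    proof (cases k)
      case 0
      then have "E = 0" using k by (simp add: E_def)
      then show ?thesis using IH(2)[OF k] 0 y by (simp add: sigma_0)
    next
      case (Suc l)
      then show ?thesis using IH k y by (simp add: sigma_snoc distrib_left)
    qed
    have len: "length (xs @ [y]) = Suc L" by (simp add: L_def)
    have vals: "partial_prod (entries (xs @ [y])) (Suc L) = P * of_int y"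
      "recip_sum (entries (xs @ [y])) (Suc L) = S + 1 / of_int y"
      "recip_pairs (entries (xs @ [y])) (Suc L) = E + S / of_int y"
      by (simp_all add: eL cong P_def S_def E_def)
    show ?case
      unfolding len vals using 1 2 3 by simp
  qed
  then show "of_int (sigma (length xs) xs) = partial_prod (entries xs) (length xs)"
    and "length xs = Suc k \<Longrightarrow> of_int (sigma k xs) =
      partial_prod (entries xs) (length xs) * recip_sum (entries xs) (length xs)"
    and "length xs = Suc (Suc k) \<Longrightarrow> of_int (sigma k xs) =
      partial_prod (entries xs) (length xs) * recip_pairs (entries xs) (length xs)"
    by auto
qed

text \<open>Dividing the equation by the product makes the pair sum 1. Entries at least 1 have
  \<open>1 / x\<^sup>2 \<le> 1 / x\<close>, so the reciprocal sum satisfies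
  \<open>S\<^sup>2 \<le> S + 2\<close>, that is \<open>(S - 2) * (S + 1) \<le> 0\<close>.\<close>

lemma sols_entries:
  assumes "xs \<in> sols n" "n \<ge> 2"
  shows "length xs = n" "\<And>i. entries xs i \<in> \<int>" "\<And>i. i < n \<Longrightarrow> 1 \<le> entries xs i"
    "\<And>i j. i \<le> j \<Longrightarrow> j < n \<Longrightarrow> entries xs i \<le> entries xs j"
    "recip_pairs (entries xs) n = 1" "recip_sum (entries xs) n \<le> 2"
proof -
  show len: "length xs = n" and "\<And>i. entries xs i \<in> \<int>"
    and ge1: "\<And>i. i < n \<Longrightarrow> 1 \<le> entries xs i"
    and "\<And>i j. i \<le> j \<Longrightarrow> j < n \<Longrightarrow> entries xs i \<le> entries xs j"
    using assms by (auto simp: sols_def entries_def sorted_iff_nth_mono)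
  obtain k where k: "n = Suc (Suc k)"
    using assms(2) by (metis Suc_le_D numeral_2_eq_2 Suc_le_mono)
  have ne: "\<forall>x\<in>set xs. x \<noteq> 0" using assms by (auto simp: sols_def)
  have P: "partial_prod (entries xs) n > 0"
    using ge1 by (intro partial_prod_pos) (auto intro: order_less_le_trans[of _ 1])
  have "sigma k xs = sigma n xs"
    using assms k by (simp add: sols_def)
  then have "partial_prod (entries xs) n * recip_pairs (entries xs) n = partial_prod (entries xs) n"
    using sigma_eq_recip(1)[OF ne] sigma_eq_recip(3)[OF ne, of k] len k by simp
  then show E: "recip_pairs (entries xs) n = 1"
    using P by simp
  have "(recip_sum (entries xs) n)\<^sup>2 \<le> recip_sum (entries xs) n + 2"
    using recip_squares_le_recip_sum[of 1 n "entries xs"] ge1 by (simp add: recip_sum_square E)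
  then have "(recip_sum (entries xs) n - 2) * (recip_sum (entries xs) n + 1) \<le> 0"
    by (simp add: power2_eq_square algebra_simps)
  moreover have "recip_sum (entries xs) n \<ge> 0"
    using ge1 by (intro recip_sum_nonneg) (auto intro: order_less_le_trans[of _ 1])
  ultimately show "recip_sum (entries xs) n \<le> 2"
    by (simp add: mult_le_0_iff)
qed

text \<open>The pairs involving the tail must fill the gap of the prefix, which is at least
  \<open>1 / partial_prod vs k\<close> by extremality. They total at most the whole sum times the
  tail sum, hence at most \<open>2 * n / x k\<close>.\<close>

lemma sols_prefix:
  assumes "xs \<in> sols n" "n \<ge> 2" "k < n"
  shows "recip_pairs (entries xs) k < 1"
    and "entries xs k \<le> 2 * real n * partial_prod vs k"
proof -
  note x = sols_entries[OF assms(1,2)]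
  define x where "x = entries xs"
  have pos: "x i > 0" if "i < n" for i
    using x(3)[OF that] by (simp add: x_def)
  obtain m where m: "n = k + Suc m"
    using assms(3) less_iff_Suc_add by auto
  define x' where "x' = (\<lambda>l. x (k + l))"
  define t where "t = recip_sum x' (Suc m)"
  have x': "x' l > 0" if "l < Suc m" for l
    using that pos m by (simp add: x'_def)
  have E: "1 = recip_pairs x k + recip_sum x k * t + recip_pairs x' (Suc m)"
    using x(5) unfolding x_def[symmetric] m recip_pairs_add by (simp add: x'_def t_def)
  show E1: "recip_pairs (entries xs) k < 1"
  proof (cases k)
    case (Suc j)
    have "1 / x 0 > 0" "1 / x k > 0" using pos assms(3) by auto
    moreover have "1 / x 0 \<le> recip_sum x k" "1 / x k \<le> t"
      using recip_mono(1)[of 1 k x] recip_mono(1)[of 1 "Suc m" x'] pos x' assms(3) Suc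
      by (simp_all add: x'_def t_def)
    ultimately have "recip_sum x k * t > 0" by (intro mult_pos_pos) linarith+
    moreover have "recip_pairs x' (Suc m) \<ge> 0"
      using x' by (rule recip_pairs_nonneg)
    ultimately show ?thesis using E by (simp add: x_def)
  qed simp
  have "recip_pairs x k \<le> recip_pairs vs k"
    unfolding x_def using x E1 assms(3) by (intro recip_pairs_le_vs) auto
  then have "1 / partial_prod vs k \<le> recip_sum x k * t + recip_pairs x' (Suc m)"
    using E recip_pairs_vs[of k] by simp
  also have "\<dots> \<le> recip_sum x k * t + t\<^sup>2"
    using recip_sum_square[of x' "Suc m"] recip_squares_nonneg[of x' "Suc m"]
      recip_pairs_nonneg[of "Suc m" x', OF x'] unfolding t_def by simp
  also have "\<dots> = recip_sum x n * t"
    unfolding m recip_sum_add by (simp add: x'_def t_def power2_eq_square distrib_right)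
  also have "\<dots> \<le> 2 * t"
    using x(6) recip_sum_nonneg[of "Suc m" x', OF x'] unfolding t_def x_def
    by (intro mult_right_mono) auto
  also have "t \<le> (\<Sum>i<Suc m. 1 / x k)"
    unfolding t_def recip_sum_def using x(4) m pos[of k]
    by (intro sum_mono frac_le) (auto simp: x'_def x_def)
  also have "\<dots> \<le> real n / x k"
    using m pos[of k] by (simp add: divide_right_mono)
  finally have "1 / partial_prod vs k \<le> 2 * (real n / x k)" by simp
  then show "entries xs k \<le> 2 * real n * partial_prod vs k"
    using partial_prod_vs_pos[of k] pos[OF assms(3)] by (simp add: x_def field_simps)
qed

section \<open>Counting prefixes and their completions\<close>

lemma card_bounded_lists:
  fixes A :: "nat \<Rightarrow> 'a set"
  assumes "\<And>k. k < m \<Longrightarrow> finite (A k)"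
  shows "finite {ys. length ys = m \<and> (\<forall>k<m. ys ! k \<in> A k)} \<and>
    card {ys. length ys = m \<and> (\<forall>k<m. ys ! k \<in> A k)} \<le> (\<Prod>k<m. card (A k))"
  using assms
proof (induction m)
  case 0
  have "{ys :: 'a list. length ys = 0 \<and> (\<forall>k<0. ys ! k \<in> A k)} = {[]}" by auto
  then show ?case by simp
next
  case (Suc m)
  define X where "X = {ys. length ys = m \<and> (\<forall>k<m. ys ! k \<in> A k)}"
  have IH: "finite X" "card X \<le> (\<Prod>k<m. card (A k))"
    using Suc by (auto simp: X_def)
  have fin: "finite (X \<times> A m)" using IH Suc.prems by simp
  have sub: "{ys. length ys = Suc m \<and> (\<forall>k<Suc m. ys ! k \<in> A k)}
      \<subseteq> (\<lambda>(ys, y). ys @ [y]) ` (X \<times> A m)"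
  proof
    fix zs assume zs: "zs \<in> {ys. length ys = Suc m \<and> (\<forall>k<Suc m. ys ! k \<in> A k)}"
    have "zs = take m zs @ [zs ! m]"
      using zs take_Suc_conv_app_nth[of m zs] by simp
    moreover have "(take m zs, zs ! m) \<in> X \<times> A m"
      using zs by (auto simp: X_def)
    ultimately show "zs \<in> (\<lambda>(ys, y). ys @ [y]) ` (X \<times> A m)"
      by (metis (mono_tags, lifting) case_prod_conv image_eqI)
  qed
  have "card ((\<lambda>(ys, y). ys @ [y]) ` (X \<times> A m)) \<le> card X * card (A m)"
    using card_image_le[OF fin] by (metis card_cartesian_product)
  also have "\<dots> \<le> (\<Prod>k<Suc m. card (A k))"
    using IH(2) by simp
  finally show ?case
    using sub fin by (meson card_mono finite_imageI finite_subset order_trans)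
qed

text \<open>
  With \<open>A > 0\<close>, the equation reads \<open>(A y - B) (A z - B) = B\<^sup>2 + A P\<close>, so a solution is determined
  by the divisor \<open>A y - B\<close>.
\<close>

lemma card_factor_pairs:
  fixes A B P :: int
  assumes "A > 0" "B \<ge> 0" "P > 0"
  defines "X \<equiv> {(y, z). 1 \<le> y \<and> 1 \<le> z \<and> A * (y * z) = B * (y + z) + P}"
  shows "finite X \<and> card X \<le> num_divisors (nat (B\<^sup>2 + A * P))"
proof -
  define f where "f = (\<lambda>(y, z :: int). nat (A * y - B))"
  have N: "B\<^sup>2 + A * P > 0"
    using assms by (intro add_nonneg_pos) auto
  \<comment> \<open>Positive values survive the conversion to \<open>nat\<close>, so the divisor
    determines \<open>y\<close>; cancelling \<open>A * y - B\<close> then recovers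
    \<open>z\<close>.\<close>
  have pos: "A * y - B > 0" if "(y, z) \<in> X" for y z
  proof -
    have "(A * y - B) * z = B * y + P"
      using that by (simp add: X_def algebra_simps)
    moreover have "B * y + P > 0"
      using that assms by (intro add_nonneg_pos) (auto simp: X_def)
    ultimately have "(A * y - B) * z > 0" by simp
    then show ?thesis using that by (auto simp: X_def zero_less_mult_iff)
  qed
  have inj: "inj_on f X"
  proof (rule inj_onI, clarify)
    fix y z y' z' assume X: "(y, z) \<in> X" "(y', z') \<in> X" and eq: "f (y, z) = f (y', z')"
    have "A * y - B = A * y' - B"
      using pos[OF X(1)] pos[OF X(2)] eq by (simp add: f_def eq_nat_nat_iff)
    then have y: "y = y'" using assms by simp
    have "(A * y - B) * z = (A * y - B) * z'"
      using X y by (simp add: X_def algebra_simps)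
    then show "y = y' \<and> z = z'" using y pos[OF X(1)] by simp
  qed
  have sub: "f ` X \<subseteq> {d. d dvd nat (B\<^sup>2 + A * P)}"
  proof clarify
    fix y z assume X: "(y, z) \<in> X"
    have "B\<^sup>2 + A * P = (A * y - B) * (A * z - B)"
    proof -
      have "(A * y - B) * (A * z - B) = A * (A * (y * z)) - A * B * (y + z) + B\<^sup>2"
        by (simp add: power2_eq_square algebra_simps)
      also have "A * (A * (y * z)) = A * (B * (y + z) + P)"
        using X by (simp add: X_def)
      finally show ?thesis by (simp add: algebra_simps)
    qed
    then have "A * y - B dvd B\<^sup>2 + A * P" by simp
    then show "f (y, z) dvd nat (B\<^sup>2 + A * P)"
      using pos[OF X] N by (simp add: f_def nat_dvd_iff)
  qed
  have fin: "finite {d. d dvd nat (B\<^sup>2 + A * P)}"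
    using N by simp
  show ?thesis
    unfolding num_divisors_def
    using card_inj_on_le[OF inj sub fin] finite_imageD[OF finite_subset[OF sub fin] inj] by simp
qed

text \<open>For \<open>n > 0\<close> the reciprocal sum contains \<open>1 / vs 0 = 1\<close>, and
  \<open>vs n = 1 + S * P\<close>.\<close>

lemma partial_prod_vs_le: "partial_prod vs n \<le> vs n"
proof (cases n)
  case (Suc m)
  have "1 \<le> recip_sum vs n"
    using recip_mono(1)[of 1 n vs] Suc vs_pos by (simp add: vs_small)
  then have "1 * partial_prod vs n \<le> recip_sum vs n * partial_prod vs n"
    using partial_prod_vs_pos[of n] by (intro mult_right_mono) auto
  then show ?thesis using vs_eq[of n] by simp
qed (simp add: vs_small)

text \<open>\<open>M\<close> bounds both the number of prefixes of length \<open>n - 2\<close> and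
  the product of each such prefix; the latter bounds the integer whose divisors encode the last two
  entries.\<close>

lemma num_sols_le:
  fixes C \<delta> :: real
  assumes "n \<ge> 4" "\<delta> > 0" "C \<ge> 0"
    and divisors: "\<And>N. N > 0 \<Longrightarrow> num_divisors N \<le> C * real N powr \<delta>"
  defines "M \<equiv> (2 * real n) ^ (n - 2) * partial_prod vs (n - 2)"
  shows "num_sols n \<le> M * (C * (5 * M\<^sup>2) powr \<delta>)"
proof -
  obtain l where l: "n = Suc (Suc (Suc (Suc l)))"
    using le_Suc_ex[OF assms(1)] by (auto simp: numeral_eq_Suc)
  define m where "m = Suc (Suc l)"
  have n: "n = Suc (Suc m)" "n \<ge> 2" using l by (simp_all add: m_def)
  define b where "b k = 2 * real n * partial_prod vs k" for k
  have b: "b k > 0" for k using partial_prod_vs_pos[of k] n by (simp add: b_def)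
  have "(\<Prod>k<m. b k) = (2 * real n) ^ m * (\<Prod>k<m. partial_prod vs k)"
    by (simp add: b_def prod.distrib)
  \<comment> \<open>Each partial product is at most the next term of \<open>vs\<close>, so
    multiplying them gives at most the product of the terms.\<close>
  also have "\<dots> \<le> (2 * real n) ^ m * partial_prod vs m"
    unfolding partial_prod_def[of vs m] using partial_prod_vs_pos partial_prod_vs_le
    by (intro mult_left_mono prod_mono) (auto simp: less_imp_le)
  finally have prod_b: "(\<Prod>k<m. b k) \<le> M"
    using n by (simp add: M_def)
  have entries_take: "entries (take m xs) i = entries xs i" if "i < m" for xs i
    using that by (simp add: entries_def)
  define T where "T = take m ` sols n"
  define A where "A k = {1..\<lfloor>b k\<rfloor>}" for k
  have sub: "T \<subseteq> {ys. length ys = m \<and> (\<forall>k<m. ys ! k \<in> A k)}"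
  proof (clarsimp simp: T_def)
    fix xs assume xs: "xs \<in> sols n"
    note x = sols_entries[OF xs n(2)]
    show "min (length xs) m = m \<and> (\<forall>k<m. xs ! k \<in> A k)"
    proof (intro conjI allI impI)
      fix k assume k: "k < m"
      then have "of_int (xs ! k) \<le> b k" "1 \<le> xs ! k"
        using sols_prefix(2)[OF xs n(2), of k] x(3)[of k] n
        by (simp_all add: entries_def b_def)
      then show "xs ! k \<in> A k" by (simp add: A_def le_floor_iff)
    qed (use x(1) n in simp)
  qed
  have finT: "finite T" using finite_sols by (simp add: T_def)
  have "card T \<le> (\<Prod>k<m. card (A k))"
    using card_bounded_lists[of m A] card_mono[OF _ sub] unfolding A_def
    by (metis (no_types, lifting) finite_atLeastAtMost_int order_trans)
  then have "real (card T) \<le> (\<Prod>k<m. real (card (A k)))"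
    by (metis of_nat_le_iff of_nat_prod)
  also have "\<dots> \<le> (\<Prod>k<m. b k)"
    using b by (intro prod_mono) (auto simp: A_def less_imp_le)
  finally have card_T: "real (card T) \<le> M" using prod_b by simp
  have fiber: "real (card {xs \<in> sols n. take m xs = ys}) \<le> C * (5 * M\<^sup>2) powr \<delta>" if "ys \<in> T" for ys
  proof -
    obtain xs where xs: "xs \<in> sols n" "ys = take m xs"
      using \<open>ys \<in> T\<close> by (auto simp: T_def)
    note x = sols_entries[OF xs(1) n(2)]
    define P S E where "P = partial_prod (entries ys) m" and "S = recip_sum (entries ys) m"
      and "E = recip_pairs (entries ys) m"
    have pos: "entries xs i > 0" if "i < n" for i
      using x(3)[OF that] by simp
    have "entries ys i = entries xs i" if "i < m" for i
      using entries_take[OF that] xs by simp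
    note cong = recip_cong[of m, OF this]
    have len: "length ys = m" using x(1) n xs(2) by simp
    have E: "E < 1" "E \<ge> 0"
      using sols_prefix(1)[OF xs(1) n(2), of m] n recip_pairs_nonneg[of m "entries xs"] pos
      by (simp_all add: E_def cong)
    have S: "S \<le> 2" "S \<ge> 0"
      using x(6) recip_mono(1)[of m n "entries xs"] recip_sum_nonneg[of m "entries xs"] pos n
      by (simp_all add: S_def cong)
    have P_eq: "P = partial_prod (entries xs) m"
      using cong(4) by (simp add: P_def)
    have P: "P > 0"
      unfolding P_eq using pos n by (intro partial_prod_pos) auto
    have "P \<le> (\<Prod>k<m. b k)"
      unfolding P_eq partial_prod_def
      using sols_prefix(2)[OF xs(1) n(2)] pos n
      by (intro prod_mono) (auto simp: b_def less_imp_le)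
    then have PM: "P \<le> M" using prod_b by simp
    \<comment> \<open>Expanding both sides in the last two entries \<open>y\<close>,
      \<open>z\<close> turns the equation into
      \<open>Ai * (y * z) = Bi * (y + z) + Pi\<close>.\<close>
    define Ai Bi Pi where "Ai = sigma m ys - sigma l ys" and "Bi = sigma (Suc l) ys"
      and "Pi = sigma m ys"
    have nz: "\<forall>x\<in>set ys. x \<noteq> 0"
      using xs by (fastforce simp: sols_def dest: in_set_takeD)
    have reals: "of_int Pi = P" "of_int Bi = P * S" "of_int Ai = P * (1 - E)"
      using sigma_eq_recip(1)[OF nz] sigma_eq_recip(2)[OF nz, of "Suc l"]
        sigma_eq_recip(3)[OF nz, of l]
      by (simp_all add: Ai_def Bi_def Pi_def P_def S_def E_def len m_def[symmetric] right_diff_distrib)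
    have "0 < real_of_int Ai" "0 \<le> real_of_int Bi" "0 < real_of_int Pi"
      unfolding reals using P E S by auto
    then have signs: "0 < Ai" "0 \<le> Bi" "0 < Pi" by simp_all
    define X where "X = {(y, z). 1 \<le> y \<and> 1 \<le> z \<and> Ai * (y * z) = Bi * (y + z) + Pi}"
    define f where "f zs = (zs ! m, zs ! Suc m)" for zs :: "int list"
    have split: "zs = (ys @ [zs ! m]) @ [zs ! Suc m]" "zs \<in> sols n"
      if "zs \<in> {xs \<in> sols n. take m xs = ys}" for zs
    proof -
      show zs: "zs \<in> sols n" using that by simp
      then have "length zs = Suc (Suc m)" using n by (simp add: sols_def)
      then have "zs = (take m zs @ [zs ! m]) @ [zs ! Suc m]"
        using take_Suc_conv_app_nth[of m zs] take_Suc_conv_app_nth[of "Suc m" zs] by simp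
      then show "zs = (ys @ [zs ! m]) @ [zs ! Suc m]"
        using that by simp
    qed
    have inj: "inj_on f {xs \<in> sols n. take m xs = ys}"
    proof (rule inj_on_inverseI[where g = "\<lambda>(y, z). (ys @ [y]) @ [z]"])
      fix zs assume "zs \<in> {xs \<in> sols n. take m xs = ys}"
      then show "(case f zs of (y, z) \<Rightarrow> (ys @ [y]) @ [z]) = zs"
        unfolding f_def prod.case by (rule split(1)[symmetric])
    qed
    have img: "f ` {xs \<in> sols n. take m xs = ys} \<subseteq> X"
    proof (rule image_subsetI)
      fix zs assume zs: "zs \<in> {xs \<in> sols n. take m xs = ys}"
      define y z where "y = zs ! m" and "z = zs ! Suc m"
      have eq: "zs = (ys @ [y]) @ [z]" using split(1)[OF zs] by (simp add: y_def z_def)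
      have "sigma n zs = z * (y * Pi)"
        unfolding eq n(1) sigma_snoc Pi_def by (simp add: sigma_eq_0 len)
      moreover have "sigma m zs = Pi + y * Bi + z * (Bi + y * sigma l ys)"
        unfolding eq m_def sigma_snoc by (simp add: Pi_def Bi_def m_def)
      moreover have "sigma m zs = sigma n zs"
        using split(2)[OF zs] n(1) by (simp add: sols_def)
      ultimately have "Ai * (y * z) = Bi * (y + z) + Pi"
        unfolding Ai_def Pi_def[symmetric] by (simp add: algebra_simps)
      moreover have "1 \<le> y" "1 \<le> z"
        using split(2)[OF zs] eq by (auto simp: sols_def)
      ultimately show "f zs \<in> X" by (simp add: X_def f_def y_def z_def)
    qed
    have X: "finite X" "card X \<le> num_divisors (nat (Bi\<^sup>2 + Ai * Pi))"
      using card_factor_pairs[OF signs] by (auto simp: X_def)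
    have N: "Bi\<^sup>2 + Ai * Pi > 0"
      using signs by (intro add_nonneg_pos) auto
    have "real (card {xs \<in> sols n. take m xs = ys}) \<le> real (num_divisors (nat (Bi\<^sup>2 + Ai * Pi)))"
      using card_inj_on_le[OF inj img X(1)] X(2) by simp
    also have "\<dots> \<le> C * real (nat (Bi\<^sup>2 + Ai * Pi)) powr \<delta>"
      using N by (intro divisors) simp
    also have "real (nat (Bi\<^sup>2 + Ai * Pi)) = (P * S)\<^sup>2 + P * (1 - E) * P"
      using N by (simp add: reals)
    also have "C * \<dots> powr \<delta> \<le> C * (5 * M\<^sup>2) powr \<delta>"
    proof (intro mult_left_mono powr_mono2)
      \<comment> \<open>The factor 5 is \<open>4 + 1\<close>, from \<open>S \<le> 2\<close> and
        \<open>1 - E \<le> 1\<close>.\<close>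
      have "(P * S)\<^sup>2 \<le> (M * 2)\<^sup>2"
        using P S PM by (intro power_mono mult_mono) auto
      moreover have "P * (1 - E) * P \<le> M * 1 * M"
        using P E PM by (intro mult_mono) auto
      ultimately show "(P * S)\<^sup>2 + P * (1 - E) * P \<le> 5 * M\<^sup>2"
        by (simp add: power2_eq_square)
    qed (use assms P E in auto)
    finally show ?thesis .
  qed
  define F where "F ys = {xs \<in> sols n. take m xs = ys}" for ys
  have "sols n = (\<Union>ys\<in>T. F ys)"
    by (auto simp: T_def F_def)
  then have "num_sols n \<le> (\<Sum>ys\<in>T. card (F ys))"
    using card_UN_le[OF finT, of F] by (simp add: num_sols_def)
  then have "real (num_sols n) \<le> (\<Sum>ys\<in>T. real (card (F ys)))"
    unfolding of_nat_sum[symmetric] of_nat_le_iff .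
  also have "\<dots> \<le> (\<Sum>ys\<in>T. C * (5 * M\<^sup>2) powr \<delta>)"
    using fiber unfolding F_def by (intro sum_mono)
  also have "\<dots> = real (card T) * (C * (5 * M\<^sup>2) powr \<delta>)"
    by simp
  also have "\<dots> \<le> M * (C * (5 * M\<^sup>2) powr \<delta>)"
    using card_T \<open>C \<ge> 0\<close> by (intro mult_right_mono) auto
  finally show ?thesis .
qed

section \<open>Doubly exponential growth and the final estimate\<close>

lemma partial_prod_vs_Suc_ge: "(partial_prod vs n)\<^sup>2 \<le> partial_prod vs (Suc n)"
  unfolding power2_eq_square partial_prod_Suc
  by (intro mult_left_mono partial_prod_vs_le less_imp_le partial_prod_vs_pos)

text \<open>Repeated squaring, starting from \<open>partial_prod vs 2 = 2\<close>.\<close>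

lemma partial_prod_vs_growth: "2 ^ 2 ^ k \<le> partial_prod vs (k + 2)"
proof (induction k)
  case 0
  then show ?case by (simp add: numeral_2_eq_2 vs_small)
next
  case (Suc k)
  have "(2 :: real) ^ 2 ^ Suc k = (2 ^ 2 ^ k)\<^sup>2"
    by (simp add: power_mult[symmetric] mult.commute)
  also have "\<dots> \<le> (partial_prod vs (k + 2))\<^sup>2"
    using Suc by (intro power_mono) auto
  also have "\<dots> \<le> partial_prod vs (Suc k + 2)"
    using partial_prod_vs_Suc_ge[of "k + 2"] by simp
  finally show ?case .
qed

theorem corollary14:
  fixes \<epsilon> :: real
  assumes "\<epsilon> > 0"
  shows "\<exists>n0\<ge>3. \<forall>n\<ge>n0. real (num_sols n) < vseq n powr (1 / 2 + \<epsilon>)"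
proof -
  \<comment> \<open>The divisor bound for \<open>5 * M\<^sup>2\<close> costs
    \<open>v powr \<delta>\<close>, and absorbing the constants and the powers of \<open>n\<close>
    costs another; together this is \<open>v powr \<epsilon>\<close>.\<close>
  define \<delta> where "\<delta> = \<epsilon> / 2"
  have \<delta>: "\<delta> > 0" using assms by (simp add: \<delta>_def)
  obtain C :: real where C: "C \<ge> 1" "\<And>N. N > 0 \<Longrightarrow> num_divisors N \<le> C * real N powr \<delta>"
    using num_divisors_bound[OF \<delta>] by blast
  \<comment> \<open>This is the absorption of constants and powers of \<open>n\<close>, in
    logarithms; the right-hand side will be at most \<open>\<delta> * ln v\<close>.\<close>
  have "eventually (\<lambda>n. ln (C * 5 powr \<delta>) + (1 + 2 * \<delta>) * (real n * ln (2 * real n))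
      < \<delta> * (ln 2 * (2 powr (real n - 3)))) sequentially"
    using \<delta> by real_asymp
  then obtain n1 where n1: "\<And>n. n \<ge> n1 \<Longrightarrow>
      ln (C * 5 powr \<delta>) + (1 + 2 * \<delta>) * (real n * ln (2 * real n))
      < \<delta> * (ln 2 * (2 powr (real n - 3)))"
    by (auto simp: eventually_sequentially)
  have "real (num_sols n) < vseq n powr (1 / 2 + \<epsilon>)" if n: "n \<ge> max 4 n1" for n
  proof -
    have n4: "n \<ge> 4" using n by simp
    define v p G M where "v = vseq n" and "p = partial_prod vs (n - 2)"
      and "G = (2 * real n) ^ n" and "M = (2 * real n) ^ (n - 2) * p"
    have p: "p > 0" using partial_prod_vs_pos by (simp add: p_def)
    have G: "G > 0" using n4 by (simp add: G_def)
    \<comment> \<open>The exponent \<open>1 / 2\<close> originates here: with the shifted index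
      \<open>v = vs (n - 1)\<close>, which is at least the product of the first \<open>n - 1\<close>
      terms and hence at least \<open>p\<^sup>2\<close>.\<close>
    have "Suc (n - 2) = n - 1" using n4 by simp
    then have "p\<^sup>2 \<le> partial_prod vs (n - 1)"
      using partial_prod_vs_Suc_ge[of "n - 2"] by (simp only: p_def)
    also have "\<dots> \<le> v"
      using partial_prod_vs_le[of "n - 1"] n4 by (simp add: v_def vs_def)
    finally have pv: "p\<^sup>2 \<le> v" .
    have v: "v > 0" using pv p by (meson order_less_le_trans zero_less_power)
    have "(2 :: real) ^ 2 ^ (n - 3) = (2 ^ 2 ^ (n - 4))\<^sup>2"
    proof -
      have "n - 3 = Suc (n - 4)" using n4 by simp
      then show ?thesis by (simp add: power_mult[symmetric] mult.commute)
    qed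
    also have "\<dots> \<le> p\<^sup>2"
    proof (rule power_mono)
      have "n - 4 + 2 = n - 2" using n4 by simp
      then show "2 ^ 2 ^ (n - 4) \<le> p"
        using partial_prod_vs_growth[of "n - 4"] by (simp only: p_def)
    qed simp
    finally have "2 ^ 2 ^ (n - 3) \<le> v" using pv by linarith
    then have "ln ((2 :: real) ^ 2 ^ (n - 3)) \<le> ln v" using v by simp
    moreover have "(2 :: real) ^ (n - 3) = 2 powr (real n - 3)"
      using n4 by (simp add: powr_realpow[symmetric] of_nat_diff)
    ultimately have ln_v: "ln 2 * 2 powr (real n - 3) \<le> ln v"
      by (simp add: ln_realpow mult.commute)
    have "ln (C * 5 powr \<delta> * G powr (1 + 2 * \<delta>))
        = ln (C * 5 powr \<delta>) + (1 + 2 * \<delta>) * (real n * ln (2 * real n))"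
      using C G n4 by (simp add: ln_mult ln_powr G_def ln_realpow distrib_left)
    also have "\<dots> < \<delta> * (ln 2 * (2 powr (real n - 3)))"
      using n1 n by simp
    also have "\<dots> \<le> \<delta> * ln v"
      using ln_v \<delta> by (intro mult_left_mono) auto
    also have "\<dots> = ln (v powr \<delta>)" using v by (simp add: ln_powr)
    finally have "ln (C * 5 powr \<delta> * G powr (1 + 2 * \<delta>)) < ln (v powr \<delta>)" .
    moreover have "C * 5 powr \<delta> * G powr (1 + 2 * \<delta>) > 0" "v powr \<delta> > 0"
      using C G v by auto
    ultimately have small: "C * 5 powr \<delta> * G powr (1 + 2 * \<delta>) < v powr \<delta>"
      using ln_less_cancel_iff by blast
    have "p \<le> v powr (1 / 2)"
      using pv p v by (simp add: powr_half_sqrt real_le_rsqrt)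
    moreover have "(2 * real n) ^ (n - 2) \<le> G"
      unfolding G_def using n4 by (intro power_increasing) auto
    ultimately have "M \<le> G * v powr (1 / 2)"
      unfolding M_def using p G by (intro mult_mono) auto
    moreover have M: "M > 0" using p n4 by (simp add: M_def)
    ultimately have M_le: "M powr (1 + 2 * \<delta>) \<le> (G * v powr (1 / 2)) powr (1 + 2 * \<delta>)"
      using \<delta> by (intro powr_mono2) auto
    have "real (num_sols n) \<le> M * (C * (5 * M\<^sup>2) powr \<delta>)"
      using num_sols_le[of n \<delta> C] n4 \<delta> C by (simp add: M_def p_def)
    also have "(5 * M\<^sup>2) powr \<delta> = 5 powr \<delta> * M powr (2 * \<delta>)"
      using M by (simp add: powr_mult powr_powr flip: powr_numeral)
    also have "M * (C * (5 powr \<delta> * M powr (2 * \<delta>))) = C * 5 powr \<delta> * M powr (1 + 2 * \<delta>)"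
      using M by (simp add: powr_add)
    also have "\<dots> \<le> C * 5 powr \<delta> * (G * v powr (1 / 2)) powr (1 + 2 * \<delta>)"
      using M_le C by (intro mult_left_mono) auto
    also have "\<dots> = C * 5 powr \<delta> * G powr (1 + 2 * \<delta>) * v powr (1 / 2 + \<delta>)"
      using G v by (simp add: powr_mult powr_powr algebra_simps)
    also have "\<dots> < v powr \<delta> * v powr (1 / 2 + \<delta>)"
      using small v by (intro mult_strict_right_mono) auto
    also have "\<dots> = v powr (1 / 2 + \<epsilon>)"
      by (simp add: powr_add[symmetric] \<delta>_def add.commute)
    finally show ?thesis by (simp add: v_def)
  qed
  then show ?thesis
    by (intro exI[of _ "max 4 n1"]) auto
qed

end
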